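(* Let $(\mathcal{A},E)$ be a non-commutative random space and let $\xi_1,\xi_2,\dots\in\mathcal{A}$ be random variables. Suppose that: (i) $\{\xi_i\}_{i\ge 1}$ is a sequence of self-adjoint random variables that satisfies Condition A; (ii) every $\xi_i$ has absolute moments of all orders, which are uniformly bounded, i.e. for every positive integer $k$ there is a constant $\mu_k<\infty$ such that $E|\xi_i|^k\le \mu_k$ for all $i$; (iii) $E\xi_i=0$ and $E\xi_i^2=\sigma_i^2$ for all $i$; (iv) $(\sigma_1^2+\dots+\sigma_N^2)/N\to s$ as $N\to\infty$, where $0<s<\infty$. Then the spectral probability measure of $$S_N=\frac{\xi_1+\dots+\xi_N}{\sqrt{\sigma_1^2+\dots+\sigma_N^2}}$$ (defined for all sufficiently large $N$) converges in distribution, as $N\to\infty$, to the standard semicircle law $\mu_{SC}$.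
   Context: A non-commutative random space $(\mathcal{A},E)$ is a pair consisting of an operator algebra $\mathcal{A}$ (an algebra of linear operators on a Hilbert space, closed under taking adjoints and containing the unit $I$) and a linear functional $E$ on $\mathcal{A}$, called expectation, which is positive ($E(X^*X)\ge 0$ for all $X\in\mathcal{A}$), finite ($E(I)=1$) and tracial ($E(X_1X_2)=E(X_2X_1)$ for all $X_1,X_2\in\mathcal{A}$). Elements of $\mathcal{A}$ are called random variables. Spectral measure: if $X$ is a self-adjoint random variable with resolution of identity $X=\int_{-\infty}^{\infty}\lambda\,dP_X(\lambda)$, its spectral probability measure is the probability measure $\mu_X$ on $\mathbb{R}$ with $\mu_X((a,b])=E[P_X(b)-P_X(a)]$. It is understood that these expectations are defined and that $E f(X)=\int f\,d\mu_X$ for every $\mu_X$-summable function $f$; in particular $E(X^k)=\int\lambda^k\,d\mu_X(\lambda)$ and $E|X|^k=\int|\lambda|^k\,d\mu_X(\lambda)$. Here $|X|=(X^*X)^{1/2}$. Condition A: a sequence of zero-mean random variables $X_1,X_2,\dots$ (i.e. $E(X_i)=0$ for all $i$) satisfies Condition A if: 1. For every $k$, $E(X_kX_{i_1}\cdots X_{i_r})=0$ whenever $i_s\ne k$ for $s=1,\dots,r$. 2. For every $k\ge 2$, $E(X_k^2X_{i_1}\cdots X_{i_r})=E(X_k^2)\,E(X_{i_1}\cdots X_{i_r})$ whenever $i_s<k$ for $s=1,\dots,r$. 3. For every $k\ge 2$, $E(X_kX_{i_1}\cdots X_{i_p}X_kX_{i_{p+1}}\cdots X_{i_r})=E(X_k^2)\,E(X_{i_1}\cdots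 X_{i_p})\,E(X_{i_{p+1}}\cdots X_{i_r})$ whenever $i_s<k$ for $s=1,\dots,r$. (Indices may repeat; empty products equal $I$.) The standard semicircle law $\mu_{SC}$ is the probability distribution on $\mathbb{R}$ with density $\frac{1}{2\pi}\sqrt{4-x^2}$ for $x\in[-2,2]$ and $0$ otherwise. *)

theory Defs
  imports "HOL-Probability.Probability" "HOL-Algebra.Ring"
begin

text \<open>The norm, metric and topology come from \<open>real_inner\<close>, whose inner product is the
  real part of the complex one, which is conjugate linear in its first argument.\<close>

class complex_hilbert = real_inner + complete_space +
  fixes scaleC :: "complex \<Rightarrow> 'a \<Rightarrow> 'a"  (infixr \<open>*\<^sub>C\<close> 75)
    and cinner :: "'a \<Rightarrow> 'a \<Rightarrow> complex"
  assumes scaleC_add_right: "c *\<^sub>C (x + y) = c *\<^sub>C x + c *\<^sub>C y"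
    and scaleC_add_left: "(c + d) *\<^sub>C x = c *\<^sub>C x + d *\<^sub>C x"
    and scaleC_scaleC: "c *\<^sub>C d *\<^sub>C x = (c * d) *\<^sub>C x"
    and scaleC_of_real: "of_real r *\<^sub>C x = r *\<^sub>R x"
    and cinner_commute: "cinner x y = cnj (cinner y x)"
    and cinner_add_right: "cinner x (y + z) = cinner x y + cinner x z"
    and cinner_scaleC_right: "cinner x (c *\<^sub>C y) = c * cinner x y"
    and inner_eq_Re_cinner: "inner x y = Re (cinner x y)"

instantiation complex :: complex_hilbert
begin

definition "scaleC_complex = ((*) :: complex \<Rightarrow> complex \<Rightarrow> complex)"
definition "cinner_complex = (\<lambda>x y :: complex. cnj x * y)"

instance
  by standard
    (simp_all add: scaleC_complex_def cinner_complex_def algebra_simps scaleR_conv_of_real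
      inner_complex_def)

end

text \<open>A possibly unbounded operator is represented by its graph, a pair \<open>(x, y)\<close> meaning that
  \<open>x\<close> lies in the domain and is mapped to \<open>y\<close>. Sums, scalar multiples and products are the
  closures of the pointwise ones (the strong operations of Segal and of Murray and von Neumann);
  for bounded everywhere defined operators the closure has no effect, see the lemmas
  \<open>op_add_op_graph\<close> and \<open>op_mult_op_graph\<close> below.\<close>

type_synonym 'h oper = "('h \<times> 'h) set"

definition op_graph :: "('h \<Rightarrow> 'h) \<Rightarrow> 'h oper" where
  "op_graph F = {(x, F x) | x. True}"

definition closed_operator :: "'h::complex_hilbert oper \<Rightarrow> bool" where
  "closed_operator T \<longleftrightarrow>
     (\<forall>x y x' y'. (x, y) \<in> T \<longrightarrow> (x', y') \<in> T \<longrightarrow> (x + x', y + y') \<in> T) \<and>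
     (\<forall>c x y. (x, y) \<in> T \<longrightarrow> (c *\<^sub>C x, c *\<^sub>C y) \<in> T) \<and>
     single_valued T \<and> closure (Domain T) = UNIV \<and> closed T"

definition op_zero :: "'h::complex_hilbert oper" where
  "op_zero = UNIV \<times> {0}"

definition op_add :: "'h::complex_hilbert oper \<Rightarrow> 'h oper \<Rightarrow> 'h oper" where
  "op_add S T = closure {(x, y + z) | x y z. (x, y) \<in> S \<and> (x, z) \<in> T}"

definition op_scale :: "complex \<Rightarrow> 'h::complex_hilbert oper \<Rightarrow> 'h oper" where
  "op_scale c T = closure {(x, c *\<^sub>C y) | x y. (x, y) \<in> T}"

text \<open>The product \<open>S T\<close> applies \<open>T\<close> first, whereas relation composition is written in
  diagrammatic order.\<close>

definition op_mult :: "'h::complex_hilbert oper \<Rightarrow> 'h oper \<Rightarrow> 'h oper" where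
  "op_mult S T = closure (T O S)"

definition op_adj :: "'h::complex_hilbert oper \<Rightarrow> 'h oper" where
  "op_adj T = {(x, y). \<forall>(u, v)\<in>T. cinner v x = cinner u y}"

definition self_adjoint :: "'h::complex_hilbert oper \<Rightarrow> bool" where
  "self_adjoint T \<longleftrightarrow> closed_operator T \<and> op_adj T = T"

definition positive_operator :: "'h::complex_hilbert oper \<Rightarrow> bool" where
  "positive_operator T \<longleftrightarrow> self_adjoint T \<and> (\<forall>(x, y)\<in>T. cinner x y \<in> \<real>\<^sub>\<ge>\<^sub>0)"

text \<open>\<open>op_abs T\<close> is the positive square root of \<open>T\<^sup>* T\<close>.\<close>

definition op_abs :: "'h::complex_hilbert oper \<Rightarrow> 'h oper" where
  "op_abs T = (THE B. positive_operator B \<and> op_mult B B = op_mult (op_adj T) T)"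

definition op_ring :: "'h::complex_hilbert oper set \<Rightarrow> 'h oper ring" where
  "op_ring A = \<lparr>carrier = A, mult = op_mult, one = Id, zero = op_zero, add = op_add\<rparr>"

lemma op_add_op_graph:
  fixes F G :: "'h::complex_hilbert \<Rightarrow> 'h"
  assumes "continuous_on UNIV F" "continuous_on UNIV G"
  shows "op_add (op_graph F) (op_graph G) = op_graph (\<lambda>x. F x + G x)"
proof -
  have "closed {p :: 'h \<times> 'h. snd p = F (fst p) + G (fst p)}"
    by (intro closed_Collect_eq continuous_intros continuous_on_compose2[OF assms(1)]
        continuous_on_compose2[OF assms(2)]) auto
  moreover have "{p :: 'h \<times> 'h. snd p = F (fst p) + G (fst p)}
      = {(x, y + z) | x y z. (x, y) \<in> op_graph F \<and> (x, z) \<in> op_graph G}"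
    by (auto simp: op_graph_def)
  moreover have "{p :: 'h \<times> 'h. snd p = F (fst p) + G (fst p)} = op_graph (\<lambda>x. F x + G x)"
    by (auto simp: op_graph_def)
  ultimately show ?thesis
    unfolding op_add_def by (metis closure_closed)
qed

lemma op_mult_op_graph:
  fixes F G :: "'h::complex_hilbert \<Rightarrow> 'h"
  assumes "continuous_on UNIV F" "continuous_on UNIV G"
  shows "op_mult (op_graph F) (op_graph G) = op_graph (F \<circ> G)"
proof -
  have "closed {p :: 'h \<times> 'h. snd p = F (G (fst p))}"
    by (intro closed_Collect_eq continuous_intros continuous_on_compose2[OF assms(1)]
        continuous_on_compose2[OF assms(2)]) auto
  moreover have "{p :: 'h \<times> 'h. snd p = F (G (fst p))} = op_graph G O op_graph F"
    by (auto simp: op_graph_def)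
  moreover have "{p :: 'h \<times> 'h. snd p = F (G (fst p))} = op_graph (F \<circ> G)"
    by (auto simp: op_graph_def)
  ultimately show ?thesis
    unfolding op_mult_def by (metis closure_closed)
qed

definition orth_projection :: "('h::complex_hilbert \<Rightarrow> 'h) \<Rightarrow> bool" where
  "orth_projection p \<longleftrightarrow>
     (\<forall>x y. p (x + y) = p x + p y) \<and> (\<forall>c x. p (c *\<^sub>C x) = c *\<^sub>C p x) \<and>
     (\<forall>x. p (p x) = p x) \<and> (\<forall>x y. cinner (p x) y = cinner x (p y))"

definition resolution_of_identity :: "(real \<Rightarrow> 'h::complex_hilbert \<Rightarrow> 'h) \<Rightarrow> bool" where
  "resolution_of_identity P \<longleftrightarrow>
     (\<forall>t. orth_projection (P t)) \<and>
     (\<forall>s t x. s \<le> t \<longrightarrow> P s (P t x) = P s x) \<and>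
     (\<forall>t x. ((\<lambda>s. P s x) \<longlongrightarrow> P t x) (at_right t)) \<and>
     (\<forall>x. ((\<lambda>s. P s x) \<longlongrightarrow> 0) at_bot) \<and>
     (\<forall>x. ((\<lambda>s. P s x) \<longlongrightarrow> x) at_top)"

text \<open>The measure \<open>B \<mapsto> \<langle>x, P(B) x\<rangle>\<close>, given by its distribution function
  \<open>t \<mapsto> \<langle>x, P t x\<rangle> = \<parallel>P t x\<parallel>\<^sup>2\<close>.\<close>

definition vector_measure :: "(real \<Rightarrow> 'h::complex_hilbert \<Rightarrow> 'h) \<Rightarrow> 'h \<Rightarrow> real measure" where
  "vector_measure P x = interval_measure (\<lambda>t. (norm (P t x))\<^sup>2)"

definition spectral_domain ::
    "(real \<Rightarrow> 'h::complex_hilbert \<Rightarrow> 'h) \<Rightarrow> (real \<Rightarrow> real) \<Rightarrow> 'h set" where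
  "spectral_domain P f =
     {x. f \<in> borel_measurable borel \<and> integrable (vector_measure P x) (\<lambda>t. (f t)\<^sup>2)}"

text \<open>The operator \<open>T = \<integral> f(t) dP(t)\<close>: its quadratic form at \<open>x\<close> is the integral of \<open>f\<close> against
  \<open>vector_measure P x\<close>, and \<open>\<langle>z, T x\<rangle>\<close> is recovered by polarization.\<close>

definition spectral_integral ::
    "(real \<Rightarrow> 'h::complex_hilbert \<Rightarrow> 'h) \<Rightarrow> (real \<Rightarrow> real) \<Rightarrow> 'h oper" where
  "spectral_integral P f =
     {(x, y). x \<in> spectral_domain P f \<and>
        (\<forall>z\<in>spectral_domain P f. cinner z y =
           (\<Sum>k<4. \<i> ^ k * of_real (\<integral>t. f t \<partial>vector_measure P (x + \<i> ^ k *\<^sub>C z))) / 4)}"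

text \<open>By the spectral theorem every self-adjoint operator has exactly one resolution of the
  identity.\<close>

definition spectral_resolution :: "'h::complex_hilbert oper \<Rightarrow> real \<Rightarrow> 'h \<Rightarrow> 'h" where
  "spectral_resolution X =
     (THE P. resolution_of_identity P \<and> spectral_integral P (\<lambda>t. t) = X)"

definition borel_calculus :: "'h::complex_hilbert oper \<Rightarrow> (real \<Rightarrow> real) \<Rightarrow> 'h oper" where
  "borel_calculus X f = spectral_integral (spectral_resolution X) f"

definition is_spectral_measure ::
    "('h::complex_hilbert oper \<Rightarrow> complex) \<Rightarrow> 'h oper \<Rightarrow> real measure \<Rightarrow> bool" where
  "is_spectral_measure E X M \<longleftrightarrow> prob_space M \<and> sets M = sets borel \<and>
     (\<forall>a b. a \<le> b \<longrightarrow>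
        E (op_graph (\<lambda>x. spectral_resolution X b x - spectral_resolution X a x))
          = of_real (measure M {a<..b}))"

definition spectral_measure ::
    "('h::complex_hilbert oper \<Rightarrow> complex) \<Rightarrow> 'h oper \<Rightarrow> real measure" where
  "spectral_measure E X = (THE M. is_spectral_measure E X M)"

locale operator_algebra =
  fixes A :: "'h::complex_hilbert oper set"
  assumes closed_operator: "T \<in> A \<Longrightarrow> closed_operator T"
    and ring: "ring (op_ring A)"
    and scale_closed: "T \<in> A \<Longrightarrow> op_scale c T \<in> A"
    and scale_add_right: "S \<in> A \<Longrightarrow> T \<in> A \<Longrightarrow>
          op_scale c (op_add S T) = op_add (op_scale c S) (op_scale c T)"
    and scale_add_left: "T \<in> A \<Longrightarrow>
          op_scale (c + d) T = op_add (op_scale c T) (op_scale d T)"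
    and scale_scale: "T \<in> A \<Longrightarrow> op_scale c (op_scale d T) = op_scale (c * d) T"
    and scale_one: "T \<in> A \<Longrightarrow> op_scale 1 T = T"
    and scale_mult_left: "S \<in> A \<Longrightarrow> T \<in> A \<Longrightarrow>
          op_mult (op_scale c S) T = op_scale c (op_mult S T)"
    and scale_mult_right: "S \<in> A \<Longrightarrow> T \<in> A \<Longrightarrow>
          op_mult S (op_scale c T) = op_scale c (op_mult S T)"
    and adj_closed: "T \<in> A \<Longrightarrow> op_adj T \<in> A"
    and adj_adj: "T \<in> A \<Longrightarrow> op_adj (op_adj T) = T"
    and adj_add: "S \<in> A \<Longrightarrow> T \<in> A \<Longrightarrow> op_adj (op_add S T) = op_add (op_adj S) (op_adj T)"
    and adj_scale: "T \<in> A \<Longrightarrow> op_adj (op_scale c T) = op_scale (cnj c) (op_adj T)"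
    and adj_mult: "S \<in> A \<Longrightarrow> T \<in> A \<Longrightarrow> op_adj (op_mult S T) = op_mult (op_adj T) (op_adj S)"

text \<open>The expectation is a linear functional on \<open>A\<close>. Spectral projections, \<open>|X|\<close> and \<open>f(X)\<close> need
  not belong to \<open>A\<close>, so \<open>E\<close> is a function on all operators, of which nothing is required outside
  \<open>A\<close> except the formulas for the spectral measure. The power \<open>[^]\<close> in \<open>op_ring A\<close> is the iterated
  \<open>op_mult\<close>, whether or not its base belongs to \<open>A\<close>. The moment formulas include
  the existence of the moments, which is automatic when \<open>X\<close> is bounded.\<close>

locale nc_random_space = operator_algebra A
  for A :: "'h::complex_hilbert oper set" +
  fixes E :: "'h oper \<Rightarrow> complex"
  assumes E_add: "S \<in> A \<Longrightarrow> T \<in> A \<Longrightarrow> E (op_add S T) = E S + E T"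
    and E_scale: "T \<in> A \<Longrightarrow> E (op_scale c T) = c * E T"
    and E_positive: "T \<in> A \<Longrightarrow> E (op_mult (op_adj T) T) \<in> \<real>\<^sub>\<ge>\<^sub>0"
    and E_one: "E Id = 1"
    and E_tracial: "S \<in> A \<Longrightarrow> T \<in> A \<Longrightarrow> E (op_mult S T) = E (op_mult T S)"
    and ex_spectral_measure: "X \<in> A \<Longrightarrow> self_adjoint X \<Longrightarrow> \<exists>M. is_spectral_measure E X M"
    and E_borel_calculus: "X \<in> A \<Longrightarrow> self_adjoint X \<Longrightarrow> integrable (spectral_measure E X) f \<Longrightarrow>
          E (borel_calculus X f) = of_real (\<integral>t. f t \<partial>spectral_measure E X)"
    and integrable_moment: "X \<in> A \<Longrightarrow> self_adjoint X \<Longrightarrow>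
          integrable (spectral_measure E X) (\<lambda>t. t ^ k)"
    and E_power: "X \<in> A \<Longrightarrow> self_adjoint X \<Longrightarrow>
          E (X [^]\<^bsub>op_ring A\<^esub> (k::nat)) = of_real (\<integral>t. t ^ k \<partial>spectral_measure E X)"
    and E_abs_power: "X \<in> A \<Longrightarrow> self_adjoint X \<Longrightarrow>
          E (op_abs X [^]\<^bsub>op_ring A\<^esub> (k::nat)) = of_real (\<integral>t. \<bar>t\<bar> ^ k \<partial>spectral_measure E X)"

definition op_word :: "(nat \<Rightarrow> 'h::complex_hilbert oper) \<Rightarrow> nat list \<Rightarrow> 'h oper" where
  "op_word X is = foldr (\<lambda>i. op_mult (X i)) is Id"

text \<open>Sequences are indexed from 1; the value at 0 is irrelevant.\<close>

definition condition_A ::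
    "('h::complex_hilbert oper \<Rightarrow> complex) \<Rightarrow> (nat \<Rightarrow> 'h oper) \<Rightarrow> bool" where
  "condition_A E X \<longleftrightarrow>
     (\<forall>i\<ge>1. E (X i) = 0) \<and>
     (\<forall>k\<ge>1. \<forall>is. set is \<subseteq> {1..} - {k} \<longrightarrow> E (op_mult (X k) (op_word X is)) = 0) \<and>
     (\<forall>k\<ge>2. \<forall>is. set is \<subseteq> {1..<k} \<longrightarrow>
        E (op_mult (op_mult (X k) (X k)) (op_word X is))
          = E (op_mult (X k) (X k)) * E (op_word X is)) \<and>
     (\<forall>k\<ge>2. \<forall>is js. set is \<subseteq> {1..<k} \<longrightarrow> set js \<subseteq> {1..<k} \<longrightarrow>
        E (op_mult (X k) (op_mult (op_word X is) (op_mult (X k) (op_word X js))))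
          = E (op_mult (X k) (X k)) * E (op_word X is) * E (op_word X js))"

definition semicircle_measure :: "real measure" where
  "semicircle_measure =
     density lborel (\<lambda>x. ennreal (if \<bar>x\<bar> \<le> 2 then sqrt (4 - x\<^sup>2) / (2 * pi) else 0))"

end

theory Submission
  imports Defs
begin

text \<open>
  The proof is by the method of moments. Let \<open>T n = \<xi> 1 + \<dots> + \<xi> n\<close> and expand
  \<open>(T n + \<xi> (n + 1)) ^ k\<close>. By Condition A and the trace property the terms with exactly one
  factor \<open>\<xi> (n + 1)\<close> vanish in expectation, and those with exactly two factorize, so the
  moments \<open>m k n = E (T n ^ k)\<close> satisfy
  \<open>m k (n + 1) = m k n + \<sigma>\<^sup>2 * (\<Sum>a b. m b n * m (k - 2 - b) n) + R\<close>
  with the sum over \<open>a + b \<le> k - 2\<close> and \<open>R\<close> collecting the words with at least three factors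
  \<open>\<xi> (n + 1)\<close>. A Hoelder inequality for tracial functionals gives \<open>R = O(n powr ((k - 3) / 2))\<close>.
  Up to the same error, \<open>c k * (\<sigma> 1\<^sup>2 + \<dots> + \<sigma> n\<^sup>2) powr (k / 2)\<close> satisfies this recursion when
  \<open>c k\<close> are the moments of the semicircle law, because these obey the Catalan convolution
  identity. Hence the two differ by \<open>O(n powr ((k - 1) / 2))\<close>.
\<close>

text \<open>The operators may be unbounded, so the words collected in R cannot be estimated by
  operator norms, and Condition A does not evaluate them in general. What is available is
  positivity, the trace and the absolute moments of each single \<open>\<xi> i\<close>. Hoelder's
  inequality turns these into bounds as soon as the norms of \<open>T n\<close> are known to be of
  order sqrt n, and that a priori growth comes from the same expansion, cut off one order earlier.

  The semicircle law enters as follows. In the second-order terms only the gap b between the two new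
  factors matters, and the symmetry b -> k - 2 - b replaces the number k - 1 - b of its positions by
  the mean k / 2. With V the sum of the variances, the convolution identity then turns the double
  sum into (k / 2) * c k * V^(k/2 - 1), the derivative of c k * V^(k/2) in V. The recursion is thus
  a discretized differential equation. Each of n steps adds an error of order n^((k-3)/2), and the
  normalization by V^(k/2), of order n^(k/2), leaves a total error of order 1 / sqrt n.\<close>

section \<open>A noncommutative Hoelder inequality\<close>

text \<open>Chessboard estimate: among the words maximizing the normalized value of \<open>\<tau>\<close>, take one
  with a long run of a single letter. Cutting it in half with the run at an end, Cauchy-Schwarz
  shows that the reflection of that half is again maximal, and its run is twice as long. Hence a
  constant word is maximal.\<close>

lemma chessboard_bound:
  fixes \<tau> :: "'a list \<Rightarrow> complex" and g :: "'a \<Rightarrow> real"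
  assumes fin: "finite S"
    and cyc: "\<And>u v. set u \<subseteq> S \<Longrightarrow> set v \<subseteq> S \<Longrightarrow> \<tau> (u @ v) = \<tau> (v @ u)"
    and cs: "\<And>u v. set u \<subseteq> S \<Longrightarrow> set v \<subseteq> S \<Longrightarrow>
               (cmod (\<tau> (u @ v)))\<^sup>2 \<le> cmod (\<tau> (u @ rev u)) * cmod (\<tau> (rev v @ v))"
    and pos: "\<And>x. x \<in> S \<Longrightarrow> g x > 0"
    and bound: "\<And>x. x \<in> S \<Longrightarrow> cmod (\<tau> (replicate (2 * m) x)) \<le> g x ^ (2 * m)"
    and m: "m > 0" and w: "set w \<subseteq> S" "length w = 2 * m"
  shows "cmod (\<tau> w) \<le> prod_list (map g w)"
proof -
  define G where "G u = prod_list (map g u)" for u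
  have G_pos: "G u > 0" if "set u \<subseteq> S" for u
    using that pos by (induction u) (auto simp: G_def)
  have G_app: "G (u @ v) = G u * G v" for u v by (simp add: G_def)
  have G_rev: "G (rev u) = G u" for u by (induction u) (simp_all add: G_def)
  define \<phi> where "\<phi> u = cmod (\<tau> u) / G u" for u
  define W where "W = {u. set u \<subseteq> S \<and> length u = 2 * m}"
  have "finite W" unfolding W_def using fin by (rule finite_lists_length_eq)
  have "w \<in> W" using w by (simp add: W_def)
  define M where "M = Max (\<phi> ` W)"
  have le_M: "\<phi> u \<le> M" if "u \<in> W" for u
    unfolding M_def using \<open>finite W\<close> that by simp
  have \<phi>_cyc: "\<phi> (u @ v) = \<phi> (v @ u)" if "set u \<subseteq> S" "set v \<subseteq> S" for u v
    using cyc[OF that] by (simp add: \<phi>_def G_app mult.commute)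
  have \<phi>_cs: "(\<phi> (u @ v))\<^sup>2 \<le> \<phi> (u @ rev u) * \<phi> (rev v @ v)" if "set u \<subseteq> S" "set v \<subseteq> S" for u v
    using cs[OF that] G_pos[OF that(1)] G_pos[OF that(2)]
    by (simp add: \<phi>_def G_app G_rev power2_eq_square divide_simps mult_ac)
  have "M \<le> 1"
  proof (rule ccontr)
    assume "\<not> M \<le> 1"
    then have "M > 1" by simp
    \<comment> \<open>One half has length \<open>m\<close>, so at most \<open>min r m\<close>
      letters of the run fit into it. In \<open>?p @ rev ?p\<close> they stand at both ends, and
      cyclicity joins them into one run.\<close>
    have step: "\<phi> (replicate (2 * min r m) x @ u @ rev u) = M"
      if x: "replicate (min r m) x @ u @ v \<in> W" "\<phi> (replicate (min r m) x @ u @ v) = M"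
        and u: "length u = m - min r m" for r x u v
    proof -
      let ?p = "replicate (min r m) x @ u"
      have S: "set ?p \<subseteq> S" "set v \<subseteq> S" and len: "length v = m"
        using x(1) u by (auto simp: W_def)
      have "?p @ rev ?p \<in> W" "rev v @ v \<in> W" using S len u by (auto simp: W_def)
      note le = le_M[OF this(1)] le_M[OF this(2)]
      have "M\<^sup>2 \<le> \<phi> (?p @ rev ?p) * \<phi> (rev v @ v)" using \<phi>_cs[OF S] x(2) by simp
      \<comment> \<open>Bounding the second factor by the maximum \<open>M\<close> and cancelling
        one \<open>M\<close> forces the first factor to be maximal.\<close>
      also have "\<dots> \<le> \<phi> (?p @ rev ?p) * M"
        by (intro mult_left_mono le(2)) (use G_pos[of "?p @ rev ?p"] S in \<open>auto simp: \<phi>_def\<close>)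
      finally have "M \<le> \<phi> (?p @ rev ?p)" using \<open>M > 1\<close> by (simp add: power2_eq_square)
      then have "M = \<phi> (?p @ rev ?p)" using le(1) by simp
      also have "\<dots> = \<phi> (rev (replicate (min r m) x) @ ?p @ rev u)"
        using \<phi>_cyc[of "?p @ rev u" "replicate (min r m) x"] S by auto
      also have "rev (replicate (min r m) x) @ ?p @ rev u = replicate (2 * min r m) x @ u @ rev u"
        by (simp add: mult_2 replicate_add)
      finally show ?thesis by simp
    qed
    have grow: "\<exists>x\<in>S. \<phi> (replicate (2 * m) x) = M"
      if "r > 0" "replicate r x @ u \<in> W" "\<phi> (replicate r x @ u) = M" for r x u
      using that
    proof (induction "2 * m - r" arbitrary: r u rule: less_induct)
      case less
      have len: "r + length u = 2 * m" and "x \<in> S" and uS: "set u \<subseteq> S"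
        using less.prems by (auto simp: W_def split: if_splits)
      show ?case
      proof (cases "r = 2 * m")
        case True
        then show ?thesis using less.prems len \<open>x \<in> S\<close> by auto
      next
        case False
        define t where "t = replicate (r - min r m) x @ u"
        have t: "replicate r x @ u = replicate (min r m) x @ t"
          by (simp add: t_def flip: replicate_add append_assoc)
        define a where "a = take (m - min r m) t"
        define b where "b = drop (m - min r m) t"
        have ab: "replicate r x @ u = replicate (min r m) x @ a @ b"
          unfolding t by (simp add: a_def b_def)
        have la: "length a = m - min r m" using len by (auto simp: a_def t_def)
        have aS: "set a \<subseteq> S"
          using uS \<open>x \<in> S\<close> set_take_subset[of "m - min r m" t]
          by (fastforce simp: a_def t_def split: if_splits)
        have eq: "\<phi> (replicate (2 * min r m) x @ a @ rev a) = M"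
          by (rule step[of _ _ _ b]) (use less.prems la in \<open>simp_all flip: ab\<close>)
        have "replicate (2 * min r m) x @ a @ rev a \<in> W"
          using la aS \<open>x \<in> S\<close> by (auto simp: W_def)
        \<comment> \<open>The run doubles as long as \<open>r \<le> m\<close>; from there on the
          next run fills the whole word.\<close>
        moreover have "2 * m - 2 * min r m < 2 * m - r" "2 * min r m > 0"
          using False len \<open>r > 0\<close> m by (auto simp: min_def)
        ultimately show ?thesis using less.hyps eq by blast
      qed
    qed
    have "M \<in> \<phi> ` W"
      unfolding M_def using \<open>finite W\<close> \<open>w \<in> W\<close> by (intro Max_in) auto
    then obtain u where u: "u \<in> W" "\<phi> u = M" by auto
    then obtain x u' where "u = replicate 1 x @ u'" using m by (cases u) (auto simp: W_def)
    then obtain y where y: "y \<in> S" "\<phi> (replicate (2 * m) y) = M"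
      using grow[of 1 x u'] u by auto
    have "G (replicate (2 * m) y) = g y ^ (2 * m)" by (simp add: G_def)
    with bound[OF y(1)] y(2) pos[OF y(1)] have "M \<le> 1"
      by (auto simp: \<phi>_def divide_simps split: if_splits)
    with \<open>M > 1\<close> show False by simp
  qed
  with le_M[OF \<open>w \<in> W\<close>] have "\<phi> w \<le> 1" by simp
  with G_pos[OF w(1)] show ?thesis
    by (simp add: \<phi>_def divide_simps G_def split: if_splits)
qed

text \<open>The optimal weights \<open>g x\<close> may vanish, whereas the chessboard estimate
  normalizes by them. It is therefore applied to \<open>g x + \<epsilon>\<close>, and \<epsilon>
  tends to 0.\<close>

lemma chessboard_Hoelder:
  fixes \<tau> :: "'a list \<Rightarrow> complex"
  assumes fin: "finite S"
    and cyc: "\<And>u v. set u \<subseteq> S \<Longrightarrow> set v \<subseteq> S \<Longrightarrow> \<tau> (u @ v) = \<tau> (v @ u)"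
    and cs: "\<And>u v. set u \<subseteq> S \<Longrightarrow> set v \<subseteq> S \<Longrightarrow>
               (cmod (\<tau> (u @ v)))\<^sup>2 \<le> cmod (\<tau> (u @ rev u)) * cmod (\<tau> (rev v @ v))"
    and L: "even L" "L > 0" and w: "set w \<subseteq> S" "length w = L"
  shows "cmod (\<tau> w) \<le> (\<Prod>x\<leftarrow>w. root L (cmod (\<tau> (replicate L x))))"
proof -
  define g where "g x = root L (cmod (\<tau> (replicate L x)))" for x
  have g: "g x \<ge> 0" for x using L by (simp add: g_def)
  have bound: "cmod (\<tau> w) \<le> (\<Prod>x\<leftarrow>w. g x + \<epsilon>)" if "\<epsilon> > 0" for \<epsilon>
  proof (rule chessboard_bound[OF fin cyc cs, where m = "L div 2"])
    fix x
    have "cmod (\<tau> (replicate L x)) = g x ^ L" using L by (simp add: g_def)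
    also have "\<dots> \<le> (g x + \<epsilon>) ^ L" using g[of x] that by (intro power_mono) auto
    finally show "cmod (\<tau> (replicate (2 * (L div 2)) x)) \<le> (g x + \<epsilon>) ^ (2 * (L div 2))"
      using L by simp
    show "g x + \<epsilon> > 0" using g[of x] that by linarith
    show "L div 2 > 0" using L by (auto elim: evenE)
  qed (use L w in auto)
  have "((\<lambda>\<epsilon>. \<Prod>x\<leftarrow>w. g x + \<epsilon>) \<longlongrightarrow> (\<Prod>x\<leftarrow>w. g x + 0)) (at_right 0)"
  proof (induction w)
    case (Cons x w)
    have "((\<lambda>\<epsilon>. g x + \<epsilon>) \<longlongrightarrow> g x + 0) (at_right 0)" by (intro tendsto_intros)
    from tendsto_mult[OF this Cons.IH] show ?case by simp
  qed simp
  moreover have "\<forall>\<^sub>F \<epsilon> in at_right 0. cmod (\<tau> w) \<le> (\<Prod>x\<leftarrow>w. g x + \<epsilon>)"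
    using bound by (auto simp: eventually_at_right_field intro: exI[of _ 1])
  ultimately have "cmod (\<tau> w) \<le> (\<Prod>x\<leftarrow>w. g x + 0)"
    by (intro tendsto_lowerbound) auto
  then show ?thesis by (simp add: g_def)
qed

text \<open>This covers words of odd length, which cannot be halved. Cauchy-Schwarz against the
  empty word passes from \<open>w\<close> to the palindrome \<open>w @ rev w\<close>, whose product
  of weights is the square of that of \<open>w\<close>.\<close>

lemma chessboard_Hoelder_double:
  fixes \<tau> :: "'a list \<Rightarrow> complex"
  assumes fin: "finite S"
    and cyc: "\<And>u v. set u \<subseteq> S \<Longrightarrow> set v \<subseteq> S \<Longrightarrow> \<tau> (u @ v) = \<tau> (v @ u)"
    and cs: "\<And>u v. set u \<subseteq> S \<Longrightarrow> set v \<subseteq> S \<Longrightarrow>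
               (cmod (\<tau> (u @ v)))\<^sup>2 \<le> cmod (\<tau> (u @ rev u)) * cmod (\<tau> (rev v @ v))"
    and one: "\<tau> [] = 1"
    and w: "set w \<subseteq> S" and L: "L = 2 * length w"
  shows "cmod (\<tau> w) \<le> (\<Prod>x\<leftarrow>w. root L (cmod (\<tau> (replicate L x))))"
proof (cases "w = []")
  case False
  define g where "g x = root L (cmod (\<tau> (replicate L x)))" for x
  have g: "g x \<ge> 0" for x using L by (cases "L = 0") (simp_all add: g_def)
  have "(cmod (\<tau> w))\<^sup>2 \<le> cmod (\<tau> (w @ rev w))"
    using cs[of w "[]"] w one by simp
  also have "\<dots> \<le> (\<Prod>x\<leftarrow>w @ rev w. g x)"
    unfolding g_def by (rule chessboard_Hoelder[OF fin cyc cs]) (use w False in \<open>auto simp: L\<close>)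
  also have "\<dots> = (\<Prod>x\<leftarrow>w. g x)\<^sup>2"
  proof -
    have "(\<Prod>x\<leftarrow>rev w. g x) = (\<Prod>x\<leftarrow>w. g x)" by (induction w) simp_all
    then show ?thesis by (simp add: power2_eq_square)
  qed
  finally have "(cmod (\<tau> w))\<^sup>2 \<le> (\<Prod>x\<leftarrow>w. g x)\<^sup>2" .
  moreover have "(\<Prod>x\<leftarrow>w. g x) \<ge> 0" by (induction w) (auto intro: mult_nonneg_nonneg g)
  ultimately show ?thesis unfolding g_def by (rule power2_le_imp_le)
qed (simp add: one)

section \<open>The method of moments\<close>

text \<open>The Taylor polynomials of the characteristic functions converge with the moments. A
  remainder of even order is bounded by a moment, so these bounds converge as well, and the growth
  of the moments of the limit law alone controls all remainders.\<close>

lemma weak_conv_m_moments: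
  fixes M :: "nat \<Rightarrow> real measure" and M' :: "real measure"
  assumes M: "\<And>n. real_distribution (M n)" and M': "real_distribution M'"
    and int: "\<And>n k. integrable (M n) (\<lambda>x. x ^ k)"
    and int': "\<And>k. integrable M' (\<lambda>x. x ^ k)"
    and lim: "\<And>k. (\<lambda>n. \<integral>x. x ^ k \<partial>M n) \<longlonglongrightarrow> (\<integral>x. x ^ k \<partial>M')"
    and growth: "\<And>t::real. (\<lambda>k. t ^ (2 * k) * (\<integral>x. x ^ (2 * k) \<partial>M') / fact (2 * k)) \<longlonglongrightarrow> 0"
  shows "weak_conv_m M M'"
proof (rule levy_continuity[OF M M'])
  fix t :: real
  define p where "p N k = (\<Sum>j\<le>2*k. ((\<i> * t) ^ j / fact j) * complex_of_real (\<integral>x. x ^ j \<partial>N))"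
    for N :: "real measure" and k
  define e where "e N k = 2 * (t ^ (2 * k) * (\<integral>x. x ^ (2 * k) \<partial>N) / fact (2 * k))"
    for N :: "real measure" and k
  have approx: "cmod (char N t - p N k) \<le> e N k"
    if "real_distribution N" "\<And>j. integrable N (\<lambda>x. x ^ j)" for N k
    using real_distribution.char_approx1[OF that(1), of "2 * k" t] that(2)
    by (simp add: p_def e_def power_even_abs)
  have p_lim: "(\<lambda>n. p (M n) k) \<longlonglongrightarrow> p M' k" for k
    unfolding p_def by (intro tendsto_intros lim)
  have e_lim: "(\<lambda>n. e (M n) k) \<longlonglongrightarrow> e M' k" for k
    unfolding e_def by (intro tendsto_intros lim) simp
  have e_lim': "(\<lambda>k. e M' k) \<longlonglongrightarrow> 0"
    unfolding e_def using tendsto_mult_left[OF growth[of t], of 2] by simp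
  show "(\<lambda>n. char (M n) t) \<longlonglongrightarrow> char M' t"
  proof (rule tendstoI)
    fix \<epsilon> :: real assume "\<epsilon> > 0"
    \<comment> \<open>The order \<open>k\<close> is chosen from the limit law only; \<open>n\<close>
      becomes large afterwards, for this fixed \<open>k\<close>.\<close>
    then have "\<forall>\<^sub>F k in sequentially. e M' k < \<epsilon> / 4"
      by (intro order_tendstoD(2)[OF e_lim']) simp
    then obtain k where k: "e M' k < \<epsilon> / 4" by (auto simp: eventually_sequentially)
    have "\<forall>\<^sub>F n in sequentially. e (M n) k < \<epsilon> / 4"
      by (rule order_tendstoD(2)[OF e_lim k])
    moreover have "\<forall>\<^sub>F n in sequentially. dist (p (M n) k) (p M' k) < \<epsilon> / 4"
      by (rule tendstoD[OF p_lim]) (use \<open>\<epsilon> > 0\<close> in simp)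
    ultimately show "\<forall>\<^sub>F n in sequentially. dist (char (M n) t) (char M' t) < \<epsilon>"
    proof eventually_elim
      case (elim n)
      have "cmod (char (M n) t - char M' t)
          = cmod ((char (M n) t - p (M n) k) - (char M' t - p M' k) + (p (M n) k - p M' k))"
        by simp
      also have "\<dots> \<le> cmod (char (M n) t - p (M n) k) + cmod (char M' t - p M' k)
          + cmod (p (M n) k - p M' k)"
        by (meson add_right_mono norm_triangle_ineq norm_triangle_ineq4 order_trans)
      also have "\<dots> < \<epsilon>"
        using approx[OF M int, of n k] approx[OF M' int', of k] elim k \<open>\<epsilon> > 0\<close> by (simp add: dist_norm)
      finally show ?case by (simp add: dist_norm)
    qed
  qed
qed

lemma power_over_fact_even: "(\<lambda>k. (r::real) ^ (2 * k) / fact (2 * k)) \<longlonglongrightarrow> 0"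
proof -
  have "(\<lambda>k. r ^ k / fact k) \<longlonglongrightarrow> 0"
    using summable_LIMSEQ_zero[OF summable_exp_generic[of r]] by (simp add: field_simps)
  then show ?thesis
    by (rule LIMSEQ_subseq_LIMSEQ[unfolded comp_def]) (simp add: strict_mono_def)
qed

section \<open>Moments of the semicircle law\<close>

lemma has_real_derivative_sqrt_4_minus:
  fixes x :: real
  assumes "x \<in> {-2<..<2}"
  shows "4 - x\<^sup>2 > 0"
    and "((\<lambda>x. sqrt (4 - x\<^sup>2)) has_real_derivative - x / sqrt (4 - x\<^sup>2)) (at x)"
proof -
  have "\<bar>x\<bar> < 2" using assms by auto
  then have "\<bar>x\<bar>\<^sup>2 < 2\<^sup>2" by (intro power_strict_mono) auto
  then show pos: "4 - x\<^sup>2 > 0" by simp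
  show "((\<lambda>x. sqrt (4 - x\<^sup>2)) has_real_derivative - x / sqrt (4 - x\<^sup>2)) (at x)"
    using pos by (auto intro!: derivative_eq_intros simp: field_simps)
qed

text \<open>The function x^(k+1) * (4 - x^2)^(3/2) vanishes at both end points, and its derivative
  is a polynomial times sqrt (4 - x^2). The square root is not differentiable at the end points,
  hence the interior form of the fundamental theorem.\<close>

lemma semicircle_integral_step:
  "((\<lambda>x::real. (4 * (real k + 1) * x ^ k - (real k + 4) * x ^ (k + 2)) * sqrt (4 - x\<^sup>2))
     has_integral 0) {-2..2}"
proof -
  let ?f = "\<lambda>x::real. x ^ (k + 1) * sqrt (4 - x\<^sup>2) ^ 3"
  have "((\<lambda>x::real. (4 * (real k + 1) * x ^ k - (real k + 4) * x ^ (k + 2)) * sqrt (4 - x\<^sup>2))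
      has_integral (?f 2 - ?f (-2))) {-2..2}"
  proof (rule fundamental_theorem_of_calculus_interior)
    show "continuous_on {-2..2} ?f" by (intro continuous_intros)
    fix x :: real assume x: "x \<in> {-2<..<2}"
    note pos = has_real_derivative_sqrt_4_minus(1)[OF x]
    define q where "q = sqrt (4 - x\<^sup>2)"
    have q: "q > 0" "q ^ 2 = 4 - x\<^sup>2" using pos by (simp_all add: q_def)
    have q3: "q ^ 3 = (4 - x\<^sup>2) * q" using q(2) by (simp add: power3_eq_cube power2_eq_square)
    have 1: "((\<lambda>x::real. x ^ (k + 1)) has_real_derivative (real k + 1) * x ^ k) (at x)"
      using DERIV_pow[of "k + 1" x UNIV] by (simp add: add.commute)
    have "3 * (- x / q * q ^ 2) = - 3 * x * q" using q(1) by (simp add: power2_eq_square)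
    then have 2: "((\<lambda>x::real. sqrt (4 - x\<^sup>2) ^ 3) has_real_derivative - 3 * x * q) (at x)"
      using DERIV_power[OF has_real_derivative_sqrt_4_minus(2)[OF x], of 3]
      unfolding q_def by (simp add: mult.assoc del: real_sqrt_power)
    have "(?f has_real_derivative x ^ (k + 1) * (- 3 * x * q) + (real k + 1) * x ^ k * q ^ 3) (at x)"
      using DERIV_mult'[OF 1 2] by (simp add: q_def)
    moreover have "x ^ (k + 1) * (- 3 * x * q) + (real k + 1) * x ^ k * q ^ 3
        = (4 * (real k + 1) * x ^ k - (real k + 4) * x ^ (k + 2)) * q"
      unfolding q3 by (simp add: algebra_simps power2_eq_square)
    ultimately show "(?f has_vector_derivative
        (4 * (real k + 1) * x ^ k - (real k + 4) * x ^ (k + 2)) * sqrt (4 - x\<^sup>2)) (at x)"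
      unfolding has_real_derivative_iff_has_vector_derivative[symmetric] q_def[symmetric] by simp
  qed simp
  then show ?thesis by simp
qed

lemma semicircle_integral_0: "((\<lambda>x::real. sqrt (4 - x\<^sup>2)) has_integral 2 * pi) {-2..2}"
proof -
  let ?f = "\<lambda>x::real. x * sqrt (4 - x\<^sup>2) / 2 + 2 * arcsin (x / 2)"
  have "((\<lambda>x::real. sqrt (4 - x\<^sup>2)) has_integral (?f 2 - ?f (-2))) {-2..2}"
  proof (rule fundamental_theorem_of_calculus_interior)
    show "continuous_on {-2..2} ?f" by (intro continuous_intros) auto
    fix x :: real assume x: "x \<in> {-2<..<2}"
    note pos = has_real_derivative_sqrt_4_minus(1)[OF x]
    define q where "q = sqrt (4 - x\<^sup>2)"
    have q: "q > 0" "q * q = 4 - x\<^sup>2" using pos by (simp_all add: q_def)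
    have "sqrt (1 - (x / 2)\<^sup>2) = sqrt ((4 - x\<^sup>2) / 4)" by (simp add: field_simps)
    also have "\<dots> = q / 2" by (simp add: real_sqrt_divide q_def)
    finally have half: "sqrt (1 - (x / 2)\<^sup>2) = q / 2" .
    have 1: "((\<lambda>x. x * sqrt (4 - x\<^sup>2)) has_real_derivative x * (- x / q) + 1 * q) (at x)"
      using DERIV_mult'[OF DERIV_ident has_real_derivative_sqrt_4_minus(2)[OF x]]
      by (simp add: q_def)
    have "((\<lambda>x. arcsin (x / 2)) has_real_derivative inverse (sqrt (1 - (x / 2)\<^sup>2)) * (1 / 2)) (at x)"
      by (rule DERIV_chain2[OF DERIV_arcsin]) (use x in \<open>auto intro!: derivative_eq_intros\<close>)
    then have 2: "((\<lambda>x. arcsin (x / 2)) has_real_derivative 1 / q) (at x)"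
      unfolding half by (simp add: field_simps)
    have "(?f has_real_derivative (x * (- x / q) + 1 * q) / 2 + 2 * (1 / q)) (at x)"
      by (intro DERIV_add DERIV_cdivide DERIV_cmult 1 2)
    moreover have "(x * (- x / q) + 1 * q) / 2 + 2 * (1 / q) = q"
      using q by (simp add: field_simps power2_eq_square)
    ultimately show "(?f has_vector_derivative sqrt (4 - x\<^sup>2)) (at x)"
      unfolding has_real_derivative_iff_has_vector_derivative[symmetric] q_def[symmetric] by simp
  qed simp
  then show ?thesis by simp
qed

text \<open>The integrand is odd, so reflecting the interval gives J = - J.\<close>

lemma semicircle_integral_1: "((\<lambda>x::real. x * sqrt (4 - x\<^sup>2)) has_integral 0) {-2..2}"
proof -
  have "((\<lambda>x::real. x * sqrt (4 - x\<^sup>2)) has_integral J) {-2..2}"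
    if "J = integral {-2..2} (\<lambda>x::real. x * sqrt (4 - x\<^sup>2))" for J
    unfolding that
    by (intro integrable_integral integrable_continuous_interval continuous_intros)
  then obtain J where J: "((\<lambda>x::real. x * sqrt (4 - x\<^sup>2)) has_integral J) {-2..2}" by blast
  then have "((\<lambda>x::real. - (x * sqrt (4 - x\<^sup>2))) has_integral J) {-2..2}"
    using has_integral_reflect_real[of "\<lambda>x. x * sqrt (4 - x\<^sup>2)" J 2 "-2"] by simp
  with has_integral_neg[OF J] have "J = - J" using has_integral_unique by blast
  with J show ?thesis by simp
qed

lemma has_bochner_integral_semicircle:
  "has_bochner_integral semicircle_measure (\<lambda>x. x ^ k)
     (integral {-2..2} (\<lambda>x. x ^ k * sqrt (4 - x\<^sup>2)) / (2 * pi))"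
proof -
  let ?d = "\<lambda>x::real. if \<bar>x\<bar> \<le> 2 then sqrt (4 - x\<^sup>2) / (2 * pi) else 0"
  let ?h = "\<lambda>x::real. x ^ k * sqrt (4 - x\<^sup>2)"
  have nonneg: "?d x \<ge> 0" for x :: real
    using abs_le_square_iff[of x 2] by auto
  have [measurable]: "?d \<in> borel_measurable borel" by measurable
  have "set_integrable lborel {-2..2} ?h"
    by (intro borel_integrable_atLeastAtMost' continuous_intros)
  note h = this set_borel_integral_eq_integral(2)[OF this]
  have eq: "?d x *\<^sub>R x ^ k = (indicator {-2..2} x *\<^sub>R ?h x) / (2 * pi)" for x
    by (auto simp: indicator_def)
  have "has_bochner_integral lborel (\<lambda>x. indicator {-2..2} x *\<^sub>R ?h x) (integral {-2..2} ?h)"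
    using h unfolding set_integrable_def set_lebesgue_integral_def
    by (simp add: has_bochner_integral_iff)
  then have "has_bochner_integral lborel (\<lambda>x. ?d x *\<^sub>R x ^ k) (integral {-2..2} ?h / (2 * pi))"
    unfolding eq by (rule has_bochner_integral_divide_zero)
  then show ?thesis
    unfolding semicircle_measure_def
    by (intro has_bochner_integral_density) (use nonneg in auto)
qed

text \<open>For k = 2 * p this is the recursion (p + 2) * C (p + 1) = 2 * (2 * p + 1) * C p of the
  Catalan numbers.\<close>

lemma semicircle_moment_rec:
  "(real k + 4) * (\<integral>x. x ^ (k + 2) \<partial>semicircle_measure) = 4 * (real k + 1) * (\<integral>x. x ^ k \<partial>semicircle_measure)"
proof -
  let ?h = "\<lambda>k (x::real). x ^ k * sqrt (4 - x\<^sup>2)"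
  have h: "(?h k has_integral integral {-2..2} (?h k)) {-2..2}" for k
    by (intro integrable_integral integrable_continuous_interval continuous_intros)
  have "((\<lambda>x. 4 * (real k + 1) * ?h k x - (real k + 4) * ?h (k + 2) x) has_integral
      (4 * (real k + 1) * integral {-2..2} (?h k) - (real k + 4) * integral {-2..2} (?h (k + 2)))) {-2..2}"
    by (intro has_integral_diff has_integral_mult_right h)
  then have "((\<lambda>x. (4 * (real k + 1) * x ^ k - (real k + 4) * x ^ (k + 2)) * sqrt (4 - x\<^sup>2)) has_integral
      (4 * (real k + 1) * integral {-2..2} (?h k) - (real k + 4) * integral {-2..2} (?h (k + 2)))) {-2..2}"
    by (simp only: left_diff_distrib mult.assoc)
  note has_integral_unique[OF this semicircle_integral_step[of k]]
  then show ?thesis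
    unfolding has_bochner_integral_integral_eq[OF has_bochner_integral_semicircle]
    by (simp add: field_simps)
qed

lemma semicircle_moment_0: "(\<integral>x. x ^ 0 \<partial>semicircle_measure) = 1"
  unfolding has_bochner_integral_integral_eq[OF has_bochner_integral_semicircle]
  using integral_unique[OF semicircle_integral_0] by simp

lemma semicircle_moment_1: "(\<integral>x. x ^ 1 \<partial>semicircle_measure) = 0"
  unfolding has_bochner_integral_integral_eq[OF has_bochner_integral_semicircle]
  using integral_unique[OF semicircle_integral_1] by simp

lemma real_distribution_semicircle: "real_distribution semicircle_measure"
proof -
  have int: "integrable semicircle_measure (\<lambda>x::real. 1::real)"
    using has_bochner_integral_semicircle[of 0] by (simp only: has_bochner_integral_iff power_0)
  have "measure semicircle_measure (space semicircle_measure) = 1"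
    using semicircle_moment_0 by simp
  with int have "emeasure semicircle_measure (space semicircle_measure) = 1"
    by (simp add: integrable_iff_bounded emeasure_eq_ennreal_measure less_top)
  then interpret prob_space semicircle_measure by (rule prob_spaceI)
  show ?thesis
    by unfold_locales (simp_all add: semicircle_measure_def)
qed

section \<open>The moment recursion\<close>

text \<open>In a word of length q + 2 with two marked letters, a is the position of the first one
  and b the gap between them. A gap b fits at q + 1 - b positions.\<close>

lemma sum_triangle_swap:
  fixes f :: "nat \<Rightarrow> 'a::comm_semiring_1"
  shows "(\<Sum>a<q + 2. \<Sum>b<q + 1 - a. f b) = (\<Sum>b\<le>q. of_nat (q + 1 - b) * f b)"
proof -
  have rev: "(\<Sum>a<q + 2. \<Sum>b<q + 1 - a. f b) = (\<Sum>a<q + 2. \<Sum>b<a. f b)"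
    using sum.nat_diff_reindex[of "\<lambda>a. \<Sum>b<a. f b" "q + 2"] by simp
  have "(\<Sum>a<q + 2. \<Sum>b<a. f b) = (\<Sum>b<q + 1. of_nat (q + 1 - b) * f b)" for q
  proof (induction q)
    case (Suc q)
    have "(\<Sum>b<q + 2. of_nat (q + 2 - b) * f b)
        = (\<Sum>b<q + 2. of_nat (q + 1 - b) * f b + f b)"
      by (intro sum.cong) (auto simp: Suc_diff_le algebra_simps)
    then show ?case using Suc by (simp add: sum.distrib algebra_simps)
  qed simp
  then show ?thesis unfolding rev by (simp add: lessThan_Suc_atMost)
qed

text \<open>The reflection b -> q - b preserves \<open>f\<close>, so a weight linear in b may be
  replaced by its mean value.\<close>

lemma sum_symmetric_weight:
  fixes f :: "nat \<Rightarrow> real"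
  assumes "\<And>b. b \<le> q \<Longrightarrow> f (q - b) = f b"
  shows "(\<Sum>b\<le>q. real (q + 1 - b) * f b) = (real q + 2) / 2 * (\<Sum>b\<le>q. f b)"
    and "(\<Sum>b\<le>q. real b * f b) = real q / 2 * (\<Sum>b\<le>q. f b)"
proof -
  have "(\<Sum>b\<le>q. real b * f b) = (\<Sum>b\<le>q. real (q - b) * f (q - b))"
    using sum.nat_diff_reindex[of "\<lambda>b. real b * f b" "Suc q"]
    by (simp only: lessThan_Suc_atMost diff_Suc_Suc)
  also have "\<dots> = (\<Sum>b\<le>q. real q * f b - real b * f b)"
    by (intro sum.cong) (auto simp: assms of_nat_diff algebra_simps)
  finally show *: "(\<Sum>b\<le>q. real b * f b) = real q / 2 * (\<Sum>b\<le>q. f b)"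
    by (simp add: sum_subtractf sum_distrib_left[symmetric])
  have "(\<Sum>b\<le>q. real (q + 1 - b) * f b) = (\<Sum>b\<le>q. (real q + 1) * f b - real b * f b)"
    by (intro sum.cong) (auto simp: of_nat_diff algebra_simps)
  then show "(\<Sum>b\<le>q. real (q + 1 - b) * f b) = (real q + 2) / 2 * (\<Sum>b\<le>q. f b)"
    unfolding sum_subtractf sum_distrib_left[symmetric] * by (simp add: field_simps)
qed

text \<open>These are the only facts about the semicircle moments that enter the combinatorial part;
  the density stays outside.\<close>

locale semicircle_moments =
  fixes c :: "nat \<Rightarrow> real"
  assumes c0: "c 0 = 1" and c1: "c 1 = 0"
    and c_rec: "\<And>k. (real k + 4) * c (k + 2) = 4 * (real k + 1) * c k"
begin

text \<open>The convolution sums satisfy the same two-term recursion as \<open>c\<close>. To see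
  this, weight the sum up to k + 2 by \<open>b + 2\<close>. By symmetry the mean weight is (k + 6) /
  2, while a shift of b by two turns the weight into \<open>b + 4\<close>, the coefficient that
  \<open>c_rec\<close> can absorb.\<close>

lemma convolution: "c (k + 2) = (\<Sum>b\<le>k. c b * c (k - b))"
proof (induction k rule: induct_nat_012)
  case 0
  show ?case using c_rec[of 0] c0 by simp
next
  case 1
  show ?case using c_rec[of 1] c0 c1 by simp
next
  case (ge2 k)
  let ?S = "\<lambda>k. \<Sum>b\<le>k. c b * c (k - b)"
  let ?k = "Suc (Suc k)"
  have sym: "(\<Sum>b\<le>k. real b * (c b * c (k - b))) = real k / 2 * ?S k" for k
    by (rule sum_symmetric_weight) (simp add: mult.commute)
  have "(real k + 6) / 2 * ?S ?k = (\<Sum>b\<le>?k. (real b + 2) * (c b * c (?k - b)))"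
    unfolding distrib_right sum.distrib sym sum_distrib_left[symmetric] by (simp add: field_simps)
  also have "\<dots> = 2 * c ?k + (\<Sum>b\<le>k. (real b + 4) * (c (b + 2) * c (k - b)))"
    by (simp add: sum.atMost_Suc_shift c0 c1[simplified] add.commute[of _ 4] del: sum.atMost_Suc)
  also have "(\<Sum>b\<le>k. (real b + 4) * (c (b + 2) * c (k - b)))
      = (\<Sum>b\<le>k. 4 * (real b + 1) * (c b * c (k - b)))"
    using c_rec by (intro sum.cong) (simp_all add: mult.assoc[symmetric])
  also have "\<dots> = 4 * (\<Sum>b\<le>k. real b * (c b * c (k - b))) + 4 * ?S k"
    by (simp add: sum.distrib sum_distrib_left algebra_simps)
  also have "\<dots> = (2 * real k + 4) * ?S k"
    unfolding sym by (simp add: algebra_simps)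
  finally have "(real k + 6) / 2 * ?S ?k = (2 * real k + 6) * c (k + 2)"
    using ge2.IH(1) by (simp add: algebra_simps)
  then have "(real k + 6) * ?S ?k = (real k + 6) * c (?k + 2)"
    using c_rec[of ?k] by (simp add: algebra_simps del: sum.atMost_Suc)
  then show ?case by (simp del: sum.atMost_Suc)
qed

lemma odd_zero: "odd k \<Longrightarrow> c k = 0"
proof (induction k rule: induct_nat_012)
  case (ge2 k)
  then show ?case using c_rec[of k] by simp
qed (use c1 in simp_all)

lemma even_bounds: "c (2 * k) \<in> {0..4 ^ k}"
proof (induction k)
  case (Suc k)
  have "(real (2 * k) + 4) * c (2 * Suc k) = 4 * (real (2 * k) + 1) * c (2 * k)"
    using c_rec[of "2 * k"] by simp
  then have eq: "c (2 * Suc k) = (2 * real k + 1) / (2 * real k + 4) * (4 * c (2 * k))"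
    by (simp add: field_simps)
  have "(2 * real k + 1) / (2 * real k + 4) * (4 * c (2 * k)) \<le> 1 * (4 * c (2 * k))"
    using Suc by (intro mult_right_mono) auto
  then show ?case unfolding eq using Suc by auto
qed (simp add: c0)

text \<open>The factor k / 2 is the exponent that comes down when V^(k/2) is differentiated. This
  match makes \<open>c k * W n ^ k\<close> an approximate solution of the moment recursion.\<close>

lemma double_sum:
  assumes "k \<ge> 2"
  shows "(\<Sum>a<k. \<Sum>b<k - 1 - a. c b * c (k - 2 - b)) = real k / 2 * c k"
proof -
  obtain q where k: "k = q + 2" using assms le_Suc_ex by (metis add.commute)
  have "(\<Sum>a<k. \<Sum>b<k - 1 - a. c b * c (k - 2 - b)) = (\<Sum>b\<le>q. real (q + 1 - b) * (c b * c (q - b)))"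
    using sum_triangle_swap[of "\<lambda>b. c b * c (q - b)" q] by (simp add: k)
  also have "\<dots> = (real q + 2) / 2 * (\<Sum>b\<le>q. c b * c (q - b))"
    by (rule sum_symmetric_weight) (simp add: mult.commute)
  finally show ?thesis using convolution[of q] by (simp add: k)
qed

end

text \<open>The remainders satisfy e (q + 1) = (v + \<delta>) * e q + (q + 2) * \<delta>^2 *
  v^(q+1). The coefficient (q + 2)^2 exceeds the binomial one but passes through this recursion at
  once, since n + n^2 \<le> (n + 1)^2.\<close>

lemma power_taylor2_bound:
  fixes v \<delta> :: real
  assumes "v \<ge> 0" "\<delta> \<ge> 0"
  shows "\<bar>(v + \<delta>) ^ (q + 2) - v ^ (q + 2) - real (q + 2) * \<delta> * v ^ (q + 1)\<bar>
           \<le> real (q + 2) ^ 2 * \<delta>\<^sup>2 * (v + \<delta>) ^ q"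
proof (induction q)
  case 0
  show ?case using assms by (simp add: power2_eq_square algebra_simps)
next
  case (Suc q)
  define e where "e q = (v + \<delta>) ^ (q + 2) - v ^ (q + 2) - real (q + 2) * \<delta> * v ^ (q + 1)" for q
  have "e (Suc q) = real (q + 2) * \<delta>\<^sup>2 * v ^ (q + 1) + (v + \<delta>) * e q"
    by (simp add: e_def algebra_simps power2_eq_square)
  also have "\<bar>\<dots>\<bar> \<le> real (q + 2) * \<delta>\<^sup>2 * v ^ (q + 1) + (v + \<delta>) * \<bar>e q\<bar>"
    using assms by (intro order.trans[OF abs_triangle_ineq] add_mono) (simp_all add: abs_mult)
  also have "\<dots> \<le> real (q + 2) * \<delta>\<^sup>2 * (v + \<delta>) ^ (q + 1)
      + (v + \<delta>) * (real (q + 2) ^ 2 * \<delta>\<^sup>2 * (v + \<delta>) ^ q)"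
    using Suc assms by (intro add_mono mult_left_mono power_mono) (simp_all add: e_def)
  also have "\<dots> = (real (q + 2) + real (q + 2) ^ 2) * (\<delta>\<^sup>2 * (v + \<delta>) ^ (q + 1))"
    by (simp add: algebra_simps)
  also have "\<dots> \<le> real (Suc q + 2) ^ 2 * (\<delta>\<^sup>2 * (v + \<delta>) ^ (q + 1))"
    using assms by (intro mult_right_mono) (simp_all add: power2_eq_square algebra_simps)
  finally show ?case by (simp add: e_def mult_ac)
qed


text \<open>For odd \<open>k\<close> everything vanishes, so half-integer powers of
  \<open>v\<close>, whose second derivative may blow up at 0, never need an expansion. For even
  \<open>k\<close> the Taylor remainder is of order r^(k-4), which is absorbed by r^(k-3).\<close>

lemma (in semicircle_moments) power_increment_bound:
  assumes "v \<ge> 0" "\<delta> \<ge> 0" "\<delta> \<le> B" "v + \<delta> \<le> B * r\<^sup>2" "B \<ge> 1" "r \<ge> 1" "k \<ge> 3"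
  shows "\<bar>c k * sqrt (v + \<delta>) ^ k - c k * sqrt v ^ k - \<delta> * (real k / 2 * c k * sqrt v ^ (k - 2))\<bar>
           \<le> \<bar>c k\<bar> * (real k ^ 2 * B ^ k) * r ^ (k - 3)"
proof (cases "odd k")
  case True
  then show ?thesis by (simp add: odd_zero)
next
  case False
  then obtain p where "k = 2 * p" by auto
  with \<open>k \<ge> 3\<close> have "p \<ge> 2" by simp
  define q where "q = p - 2"
  have k: "k = 2 * (q + 2)" using \<open>k = 2 * p\<close> \<open>p \<ge> 2\<close> by (simp add: q_def)
  have pow: "sqrt x ^ (2 * n) = x ^ n" if "x \<ge> 0" for x n
    using that by (simp add: power_mult)
  have "k - 2 = 2 * (q + 1)" using k by simp
  then have eq: "c k * sqrt (v + \<delta>) ^ k - c k * sqrt v ^ k - \<delta> * (real k / 2 * c k * sqrt v ^ (k - 2))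
      = c k * ((v + \<delta>) ^ (q + 2) - v ^ (q + 2) - real (q + 2) * \<delta> * v ^ (q + 1))"
    using assms(1,2) by (simp only: pow k add_nonneg_nonneg) (simp add: algebra_simps)
  have "real (q + 2) ^ 2 * \<delta>\<^sup>2 * (v + \<delta>) ^ q \<le> real k ^ 2 * B\<^sup>2 * (B * r\<^sup>2) ^ q"
    using assms k by (intro mult_mono power_mono) auto
  also have "\<dots> = real k ^ 2 * B ^ (q + 2) * r ^ (2 * q)"
    by (simp add: power_mult_distrib power_add power2_eq_square[of B] mult_ac flip: power_mult)
  also have "\<dots> \<le> real k ^ 2 * B ^ k * r ^ (k - 3)"
    using assms k by (intro mult_mono power_increasing mult_nonneg_nonneg) auto
  finally have "real (q + 2) ^ 2 * \<delta>\<^sup>2 * (v + \<delta>) ^ q \<le> real k ^ 2 * B ^ k * r ^ (k - 3)" .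
  from order.trans[OF power_taylor2_bound[OF assms(1,2), of q] this]
  show ?thesis unfolding eq abs_mult mult.assoc[of "\<bar>c k\<bar>"] by (rule mult_left_mono) simp
qed

text \<open>If each factor is known up to an error smaller than its own size by a factor
  \<open>r\<close>, so is the product: a * b - a' * b' = (a - a') * b + a' * (b - b').\<close>

lemma abs_mult_diff_bound:
  fixes a a' b b' :: real
  assumes "\<bar>a - a'\<bar> * r \<le> A * r ^ i" "\<bar>b - b'\<bar> * r \<le> B * r ^ j"
    and "\<bar>a'\<bar> \<le> A' * r ^ i" "\<bar>b'\<bar> \<le> B' * r ^ j" and r: "r \<ge> 1"
    and nn: "A \<ge> 0" "B \<ge> 0" "A' \<ge> 0" "B' \<ge> 0"
  shows "\<bar>a * b - a' * b'\<bar> * r \<le> (A * (B + B') + A' * B) * r ^ (i + j)"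
proof -
  have "\<bar>b\<bar> \<le> \<bar>b - b'\<bar> * 1 + \<bar>b'\<bar>" by simp
  also have "\<dots> \<le> \<bar>b - b'\<bar> * r + \<bar>b'\<bar>" using r by (intro add_mono mult_left_mono) auto
  also have "\<dots> \<le> (B + B') * r ^ j" using assms by (simp add: algebra_simps)
  finally have b: "\<bar>b\<bar> \<le> (B + B') * r ^ j" .
  have "\<bar>a * b - a' * b'\<bar> * r = \<bar>(a - a') * b + a' * (b - b')\<bar> * r" by (simp add: algebra_simps)
  also have "\<dots> \<le> (\<bar>(a - a') * b\<bar> + \<bar>a' * (b - b')\<bar>) * r"
    using r by (intro mult_right_mono abs_triangle_ineq) auto
  also have "\<dots> = (\<bar>a - a'\<bar> * r) * \<bar>b\<bar> + \<bar>a'\<bar> * (\<bar>b - b'\<bar> * r)"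
    by (simp only: abs_mult distrib_right mult_ac, simp add: distrib_left)
  also have "\<dots> \<le> (A * r ^ i) * ((B + B') * r ^ j) + (A' * r ^ i) * (B * r ^ j)"
    by (intro add_mono mult_mono[OF assms(1) b] mult_mono[OF assms(3,2)]) (use nn r in simp_all)
  finally show ?thesis by (simp add: power_add algebra_simps)
qed

text \<open>The error is stated multiplied by \<open>sqrt (n + 1)\<close> because for \<open>k = 0\<close> the exponent
  \<open>k - 1\<close> would be truncated.\<close>

lemma (in semicircle_moments) moment_recursion_asymptotics:
  fixes m :: "nat \<Rightarrow> nat \<Rightarrow> real" and \<delta> :: "nat \<Rightarrow> real"
  defines "W \<equiv> \<lambda>n. sqrt (\<Sum>i<n. \<delta> i)"
    and "F \<equiv> \<lambda>k n. \<delta> n * (\<Sum>a<k. \<Sum>b<k - 1 - a. m b n * m (k - 2 - b) n)"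
    and "r \<equiv> \<lambda>n. sqrt (real n + 1)"
  assumes m0: "\<And>n. m 0 n = 1" and init: "\<And>k. k > 0 \<Longrightarrow> m k 0 = 0"
    and small: "\<And>k n. k \<le> 2 \<Longrightarrow> m k (Suc n) = m k n + F k n"
    and step: "\<And>k. k \<ge> 3 \<Longrightarrow> \<exists>C. \<forall>n. \<bar>m k (Suc n) - m k n - F k n\<bar> \<le> C * r n ^ (k - 3)"
    and \<delta>: "\<And>n. \<delta> n \<ge> 0" "\<And>n. \<delta> n \<le> B"
  shows "\<exists>C. \<forall>n. \<bar>m k n - c k * W n ^ k\<bar> * r n \<le> C * r n ^ k"
proof -
  define B' where "B' = max 1 B"
  have B': "B' \<ge> 1" "\<delta> n \<le> B'" for n using \<delta>(2)[of n] by (auto simp: B'_def)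
  have r1: "r n \<ge> 1" and r2: "r n ^ 2 = real n + 1" for n by (simp_all add: r_def)
  have W0: "W n \<ge> 0" and W2: "W n ^ 2 = (\<Sum>i<n. \<delta> i)" for n
    using \<delta>(1) by (simp_all add: W_def sum_nonneg)
  have V: "(\<Sum>i<n. \<delta> i) \<le> B' * real n" for n
    using sum_bounded_above[of "{..<n}" \<delta> B'] B' by (simp add: mult.commute)
  have Wr: "W n \<le> sqrt B' * r n" for n
    unfolding W_def r_def real_sqrt_mult[symmetric] using V[of n] B'(1) 
    by (simp add: algebra_simps)
  have cW: "\<bar>c k * W n ^ k\<bar> \<le> (\<bar>c k\<bar> * sqrt B' ^ k) * r n ^ k" for k n
  proof -
    have "W n ^ k \<le> (sqrt B' * r n) ^ k" by (intro power_mono Wr W0)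
    then have "\<bar>c k\<bar> * W n ^ k \<le> \<bar>c k\<bar> * (sqrt B' * r n) ^ k" by (intro mult_left_mono) auto
    then show ?thesis using W0[of n] by (simp add: abs_mult power_mult_distrib mult.assoc)
  qed
  \<comment> \<open>The constants of smaller orders get multiplied with each other in the induction
    step, so their nonnegativity is carried along.\<close>
  have "\<exists>C\<ge>0. \<forall>n. \<bar>m k n - c k * W n ^ k\<bar> * r n \<le> C * r n ^ k"
  proof (induction k rule: less_induct)
    case (less k)
    show ?case
    proof (cases "k \<le> 2")
      case True
      \<comment> \<open>Up to order two the recursion has no remainder and the approximation is
        exact; in particular \<open>m 2 n\<close> is the sum of the variances.\<close>
      have "m k n = c k * W n ^ k" for n
      proof (cases "k = 0")
        case True
        then show ?thesis by (simp add: m0 c0)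
      next
        case False
        with \<open>k \<le> 2\<close> consider "k = 1" | "k = 2" by linarith
        then show ?thesis
        proof cases
          case 1
          have "m 1 n = 0"
            using small[of 1] init[of 1] by (induction n) (simp_all add: F_def)
          with 1 c1 show ?thesis by simp
        next
          case 2
          have "m 2 n = (\<Sum>i<n. \<delta> i)"
            using small[of 2] init[of 2]
            by (induction n) (simp_all add: F_def m0 numeral_2_eq_2)
          moreover have "c 2 = 1" using c_rec[of 0] c0 by (simp add: numeral_2_eq_2)
          ultimately show ?thesis using 2 W2 by simp
        qed
      qed
      then show ?thesis by (intro exI[of _ 0]) simp
    next
      case False
      then have k: "k \<ge> 3" by simp
      from less.IH obtain C where C: "\<And>i. i < k \<Longrightarrow> C i \<ge> 0"
        "\<And>i n. i < k \<Longrightarrow> \<bar>m i n - c i * W n ^ i\<bar> * r n \<le> C i * r n ^ i" by metis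
      from step[OF k] obtain K where
        K: "\<And>n. \<bar>m k (Suc n) - m k n - F k n\<bar> \<le> K * r n ^ (k - 3)" by blast
      define P where "P i = \<bar>c i\<bar> * sqrt B' ^ i" for i
      have P: "P i \<ge> 0" for i using B' by (simp add: P_def)
      define Q where "Q b = C b * (C (k - 2 - b) + P (k - 2 - b)) + P b * C (k - 2 - b)" for b
      have prod: "\<bar>m b n * m (k - 2 - b) n - c b * c (k - 2 - b) * W n ^ (k - 2)\<bar>
          \<le> Q b * r n ^ (k - 3)" if b: "b \<le> k - 2" for b n
      proof -
        have "\<bar>m b n * m (k - 2 - b) n - (c b * W n ^ b) * (c (k - 2 - b) * W n ^ (k - 2 - b))\<bar> * r n
            \<le> Q b * r n ^ (b + (k - 2 - b))"
          unfolding Q_def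
          by (rule abs_mult_diff_bound[OF C(2) C(2)])
             (use b k C(1) P r1 cW in \<open>auto simp: P_def\<close>)
        also have "(c b * W n ^ b) * (c (k - 2 - b) * W n ^ (k - 2 - b))
            = c b * c (k - 2 - b) * W n ^ (k - 2)"
        proof -
          have "W n ^ (k - 2) = W n ^ b * W n ^ (k - 2 - b)"
            using b by (simp only: le_add_diff_inverse flip: power_add)
          then show ?thesis by (simp only: mult_ac)
        qed
        \<comment> \<open>As \<open>k \<ge> 3\<close>, the exponent is a successor, and the factor
          \<open>r n\<close> on the left can be cancelled.\<close>
        also have "b + (k - 2 - b) = Suc (k - 3)" using b k by simp
        finally show ?thesis using r1[of n] by simp
      qed
      define Q' where "Q' = (\<Sum>a<k. \<Sum>b<k - 1 - a. Q b)"
      have F: "\<bar>F k n - \<delta> n * (real k / 2 * c k * W n ^ (k - 2))\<bar> \<le> B' * Q' * r n ^ (k - 3)" for n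
      proof -
        have eq: "F k n - \<delta> n * (real k / 2 * c k * W n ^ (k - 2))
            = \<delta> n * (\<Sum>a<k. \<Sum>b<k - 1 - a. m b n * m (k - 2 - b) n - c b * c (k - 2 - b) * W n ^ (k - 2))"
        proof -
          have "(\<Sum>a<k. \<Sum>b<k - 1 - a. m b n * m (k - 2 - b) n - c b * c (k - 2 - b) * W n ^ (k - 2))
              = (\<Sum>a<k. \<Sum>b<k - 1 - a. m b n * m (k - 2 - b) n) - real k / 2 * c k * W n ^ (k - 2)"
            unfolding sum_subtractf sum_distrib_right[symmetric]
            by (subst double_sum) (use k in simp_all)
          then show ?thesis unfolding F_def by (simp only: right_diff_distrib)
        qed
        have "\<bar>F k n - \<delta> n * (real k / 2 * c k * W n ^ (k - 2))\<bar> \<le> B' * \<bar>\<Sum>a<k. \<Sum>b<k - 1 - a.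
            m b n * m (k - 2 - b) n - c b * c (k - 2 - b) * W n ^ (k - 2)\<bar>"
          unfolding eq abs_mult using \<delta>(1)[of n] B'(2)[of n] by (intro mult_right_mono) auto
        also have "\<dots> \<le> B' * (\<Sum>a<k. \<Sum>b<k - 1 - a. Q b * r n ^ (k - 3))"
        proof (rule mult_left_mono)
          show "\<bar>\<Sum>a<k. \<Sum>b<k - 1 - a. m b n * m (k - 2 - b) n - c b * c (k - 2 - b) * W n ^ (k - 2)\<bar>
              \<le> (\<Sum>a<k. \<Sum>b<k - 1 - a. Q b * r n ^ (k - 3))"
            by (intro order.trans[OF sum_abs] sum_mono prod) auto
        qed (use B'(1) in simp)
        finally show ?thesis
          by (simp add: Q'_def sum_distrib_right mult.assoc)
      qed
      define D where "D = K + B' * Q' + \<bar>c k\<bar> * (real k ^ 2 * B' ^ k)"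
      define d where "d n = m k n - c k * W n ^ k" for n
      \<comment> \<open>Three sources of error: the remainder of the recursion, the replacement of
        the moments in \<open>F\<close> by their approximations, and the Taylor remainder of
        \<open>c k * W n ^ k\<close>.\<close>
      have incr: "\<bar>d (Suc n) - d n\<bar> \<le> D * r n ^ (k - 3)" for n
      proof -
        have W: "\<bar>c k * W (Suc n) ^ k - c k * W n ^ k - \<delta> n * (real k / 2 * c k * W n ^ (k - 2))\<bar>
            \<le> \<bar>c k\<bar> * (real k ^ 2 * B' ^ k) * r n ^ (k - 3)"
          unfolding W_def sum.lessThan_Suc
          by (rule power_increment_bound)
             (use \<delta> B' r1 k V[of "Suc n"] in \<open>auto simp: sum_nonneg r2 algebra_simps\<close>)
        have "d (Suc n) - d n = (m k (Suc n) - m k n - F k n)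
            + (F k n - \<delta> n * (real k / 2 * c k * W n ^ (k - 2)))
            - (c k * W (Suc n) ^ k - c k * W n ^ k - \<delta> n * (real k / 2 * c k * W n ^ (k - 2)))"
          by (simp add: d_def)
        moreover have "\<bar>x + y - z\<bar> \<le> p + q + s"
          if "\<bar>x\<bar> \<le> p" "\<bar>y\<bar> \<le> q" "\<bar>z\<bar> \<le> s" for x y z p q s :: real
          using that by linarith
        note this[OF K F W]
        ultimately show ?thesis by (simp only: D_def distrib_right)
      qed
      have "D * r 0 ^ (k - 3) \<ge> 0" using incr[of 0] by linarith
      then have D: "D \<ge> 0" by (simp add: r_def)
      have d_le: "\<bar>d n\<bar> \<le> D * real n * r n ^ (k - 3)" for n
      proof (induction n)
        case 0
        then show ?case using init[of k] k by (simp add: d_def W_def)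
      next
        case (Suc n)
        have "\<bar>d (Suc n)\<bar> \<le> D * real n * r n ^ (k - 3) + D * r n ^ (k - 3)"
          using Suc incr[of n] by linarith
        also have "\<dots> = D * real (Suc n) * r n ^ (k - 3)" by (simp add: algebra_simps)
        also have "\<dots> \<le> D * real (Suc n) * r (Suc n) ^ (k - 3)"
          using D by (intro mult_left_mono power_mono) (auto simp: r_def)
        finally show ?case .
      qed
      \<comment> \<open>The number of steps \<open>n\<close> is at most \<open>r n ^ 2\<close>, so
        the powers of \<open>r n\<close> add up to 2 + (k - 3) + 1 = k.\<close>
      have "D * real n * r n ^ (k - 3) * r n \<le> D * r n ^ k" for n
      proof -
        have "D * real n * r n ^ (k - 3) * r n \<le> D * r n ^ 2 * r n ^ (k - 3) * r n"
          unfolding r2 using D r1[of n] by (intro mult_right_mono mult_left_mono) auto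
        also have "\<dots> = D * r n ^ (2 + (k - 3) + 1)" by (simp only: power_add power_one_right mult_ac)
        also have "2 + (k - 3) + 1 = k" using k by simp
        finally show ?thesis .
      qed
      from order.trans[OF mult_right_mono[OF d_le] this]
      have "\<bar>d n\<bar> * r n \<le> D * r n ^ k" for n by (simp add: r_def)
      then show ?thesis using D by (auto simp: d_def)
    qed
  qed
  then show ?thesis by blast
qed

section \<open>Operator algebras and expectations\<close>

text \<open>The letters of \<open>op_word\<close> are all taken from one sequence; the words below
  mix several partial sums with the \<xi>, so their letters are the operators themselves.\<close>

definition op_prod :: "'h::complex_hilbert oper list \<Rightarrow> 'h oper" where
  "op_prod ws = foldr op_mult ws Id"

lemma op_prod_simps [simp]:
  "op_prod [] = Id" "op_prod (T # ws) = op_mult T (op_prod ws)"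
  by (simp_all add: op_prod_def)

lemma op_word_eq_op_prod: "op_word X is = op_prod (map X is)"
  by (simp add: op_word_def op_prod_def foldr_map comp_def)

context operator_algebra
begin

sublocale R: ring "op_ring A" by (rule ring)

lemma op_ring_simps [simp]:
  "carrier (op_ring A) = A" "mult (op_ring A) = op_mult" "one (op_ring A) = Id"
  "zero (op_ring A) = op_zero" "add (op_ring A) = op_add"
  by (simp_all add: op_ring_def)

lemmas mult_closed [simp, intro] = R.m_closed [unfolded op_ring_simps]
lemmas add_closed [simp, intro] = R.a_closed [unfolded op_ring_simps]
lemmas one_closed [simp, intro] = R.one_closed [unfolded op_ring_simps]
lemmas zero_closed [simp, intro] = R.zero_closed [unfolded op_ring_simps]
lemmas mult_assoc = R.m_assoc [unfolded op_ring_simps]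
lemmas mult_one [simp] = R.l_one [unfolded op_ring_simps] R.r_one [unfolded op_ring_simps]
lemmas add_zero [simp] = R.l_zero [unfolded op_ring_simps] R.r_zero [unfolded op_ring_simps]
lemmas distrib = R.l_distr [unfolded op_ring_simps] R.r_distr [unfolded op_ring_simps]

lemma op_prod_closed [simp, intro]: "set ws \<subseteq> A \<Longrightarrow> op_prod ws \<in> A"
  by (induction ws) auto

lemma op_prod_append:
  "set us \<subseteq> A \<Longrightarrow> set vs \<subseteq> A \<Longrightarrow> op_prod (us @ vs) = op_mult (op_prod us) (op_prod vs)"
  by (induction us) (auto simp: mult_assoc)

lemma op_adj_Id [simp]: "op_adj (Id :: 'h oper) = Id"
proof -
  have "(Id :: 'h oper) = op_adj (op_mult (op_adj Id) Id)"
    using adj_closed[of Id] adj_adj[of Id] by simp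
  also have "\<dots> = op_mult (op_adj Id) Id"
    using adj_mult[of "op_adj Id" Id] adj_adj[of Id] adj_closed[of Id] by simp
  also have "\<dots> = op_adj Id" using adj_closed[of Id] by simp
  finally show ?thesis by simp
qed

lemma op_adj_zero [simp]: "op_adj (op_zero :: 'h oper) = op_zero"
proof -
  have "op_add (op_adj op_zero) (op_adj op_zero) = (op_adj op_zero :: 'h oper)"
    using adj_add[of op_zero op_zero] by simp
  then show ?thesis
    using R.add.l_cancel_one[of "op_adj op_zero" "op_adj op_zero"] adj_closed[of op_zero] by simp
qed

lemma op_adj_op_prod:
  assumes "set ws \<subseteq> A" "\<And>T. T \<in> set ws \<Longrightarrow> op_adj T = T"
  shows "op_adj (op_prod ws) = op_prod (rev ws)"
  using assms by (induction ws) (auto simp: adj_mult op_prod_append)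

lemma pow_eq_op_prod: "T \<in> A \<Longrightarrow> T [^]\<^bsub>op_ring A\<^esub> (k::nat) = op_prod (replicate k T)"
proof (induction k)
  case (Suc k)
  then have "op_prod (replicate (Suc k) T) = op_mult (op_prod (replicate k T)) T"
    using op_prod_append[of "replicate k T" "[T]"]
    by (simp add: replicate_append_same set_replicate_conv_if)
  then show ?case using Suc by simp
qed simp

lemma op_prod_replicate_scale:
  assumes "T \<in> A"
  shows "op_prod (replicate k (op_scale c T)) = op_scale (c ^ k) (op_prod (replicate k T))"
proof (induction k)
  case (Suc k)
  have "op_prod (replicate k T) \<in> A" using assms by (auto simp: set_replicate_conv_if)
  with Suc assms show ?case
    by (simp add: scale_mult_left scale_mult_right scale_closed scale_scale mult.commute)
qed (simp add: scale_one)

end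

text \<open>This is the discriminant argument behind Cauchy-Schwarz. The Hermitian symmetry z' = cnj
  z is not assumed: it follows from the form being real at t = 1 and t = \<i>.\<close>

lemma cmod_square_le_of_nonneg_form:
  fixes p q :: real and z z' :: complex
  assumes nn: "\<And>t. complex_of_real p + t * z + cnj t * z' + t * cnj t * complex_of_real q \<in> \<real>\<^sub>\<ge>\<^sub>0"
    and q: "q \<ge> 0"
  shows "(cmod z)\<^sup>2 \<le> p * q"
proof -
  have "Im z + Im z' = 0" using nn[of 1] by (simp add: complex_nonneg_Reals_iff)
  moreover have "Re z - Re z' = 0" using nn[of \<i>] by (simp add: complex_nonneg_Reals_iff)
  ultimately have z': "z' = cnj z" by (simp add: complex_eq_iff)
  \<comment> \<open>The choice t = - x * cnj z aligns the phase and leaves a real quadratic in x. It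
    is evaluated at its minimum 1 / q, or, if q = 0, where it would take the value -1.\<close>
  have ineq: "p - 2 * x * (cmod z)\<^sup>2 + x\<^sup>2 * (cmod z)\<^sup>2 * q \<ge> 0" for x :: real
  proof -
    have "complex_of_real p + (- x * cnj z) * z + cnj (- x * cnj z) * z'
        + (- x * cnj z) * cnj (- x * cnj z) * complex_of_real q
        = complex_of_real p - 2 * x * (z * cnj z) + x\<^sup>2 * (z * cnj z) * q"
      unfolding z' by (simp add: algebra_simps power2_eq_square)
    also have "\<dots> = complex_of_real (p - 2 * x * (cmod z)\<^sup>2 + x\<^sup>2 * (cmod z)\<^sup>2 * q)"
      unfolding complex_norm_square[symmetric] by simp
    finally show ?thesis
      using nn[of "- x * cnj z"] by (simp only: nonneg_Reals_of_real_iff)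
  qed
  show ?thesis
  proof (cases "q = 0")
    case True
    show ?thesis
    proof (rule ccontr)
      assume "\<not> ?thesis"
      then have z: "(cmod z)\<^sup>2 > 0" using True by simp
      with ineq[of "(p + 1) / (2 * (cmod z)\<^sup>2)"] True show False by simp
    qed
  next
    case False
    then show ?thesis using ineq[of "1 / q"] q by (simp add: field_simps power2_eq_square)
  qed
qed


context nc_random_space
begin

lemma E_zero [simp]: "E op_zero = 0"
  using E_add[of op_zero op_zero] by simp

lemma E_Cauchy_Schwarz:
  assumes "S \<in> A" "T \<in> A"
  shows "(cmod (E (op_mult (op_adj S) T)))\<^sup>2
           \<le> cmod (E (op_mult (op_adj S) S)) * cmod (E (op_mult (op_adj T) T))"
proof -
  have nn: "E (op_mult (op_adj X) X) \<in> \<real>\<^sub>\<ge>\<^sub>0" if "X \<in> A" for X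
    by (rule E_positive[OF that])
  then have real: "E (op_mult (op_adj X) X) = complex_of_real (cmod (E (op_mult (op_adj X) X)))"
    if "X \<in> A" for X
    using nn[OF that] by (auto elim!: nonneg_Reals_cases)
  show ?thesis
  proof (rule cmod_square_le_of_nonneg_form[where z' = "E (op_mult (op_adj T) S)"])
    fix t :: complex
    let ?X = "op_add S (op_scale t T)"
    have "E (op_mult (op_adj ?X) ?X) = E (op_mult (op_adj S) S) + t * E (op_mult (op_adj S) T)
        + cnj t * E (op_mult (op_adj T) S) + t * cnj t * E (op_mult (op_adj T) T)"
      using assms
      by (simp add: adj_add adj_scale scale_closed adj_closed distrib E_add E_scale
          scale_mult_left scale_mult_right algebra_simps)
    with nn[of ?X] real assms
    show "complex_of_real (cmod (E (op_mult (op_adj S) S))) + t * E (op_mult (op_adj S) T)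
        + cnj t * E (op_mult (op_adj T) S)
        + t * cnj t * complex_of_real (cmod (E (op_mult (op_adj T) T))) \<in> \<real>\<^sub>\<ge>\<^sub>0"
      by (simp add: scale_closed)
  qed simp
qed

lemma E_op_prod_cyclic:
  assumes "set us \<subseteq> A" "set vs \<subseteq> A"
  shows "E (op_prod (us @ vs)) = E (op_prod (vs @ us))"
  using assms by (simp add: op_prod_append E_tracial)

text \<open>With self-adjoint letters the adjoint of a word is its reversal. This gives
  Cauchy-Schwarz the reflected form that the chessboard argument uses.\<close>

lemma E_op_prod_Cauchy_Schwarz:
  assumes "set us \<subseteq> A" "set vs \<subseteq> A" "\<And>T. T \<in> set us \<union> set vs \<Longrightarrow> op_adj T = T"
  shows "(cmod (E (op_prod (us @ vs))))\<^sup>2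
           \<le> cmod (E (op_prod (us @ rev us))) * cmod (E (op_prod (rev vs @ vs)))"
proof -
  have "op_adj (op_prod (rev us)) = op_prod us" "op_adj (op_prod vs) = op_prod (rev vs)"
    using assms op_adj_op_prod[of "rev us"] op_adj_op_prod[of vs] by auto
  then show ?thesis
    using E_Cauchy_Schwarz[of "op_prod (rev us)" "op_prod vs"] assms by (simp add: op_prod_append)
qed

lemma E_op_prod_add:
  assumes "set us \<subseteq> A" "set vs \<subseteq> A" "S \<in> A" "T \<in> A"
  shows "E (op_prod (us @ op_add S T # vs)) = E (op_prod (us @ S # vs)) + E (op_prod (us @ T # vs))"
  using assms by (simp add: op_prod_append distrib E_add)

text \<open>The words containing \<open>T\<close> are grouped by the position a of its first
  occurrence: only \<open>S\<close> stands before it, and the sum stays unexpanded after it. The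
  prefix \<open>us\<close> allows the identity to be applied again to that tail.\<close>

lemma E_op_prod_telescope:
  assumes "set us \<subseteq> A" "set vs \<subseteq> A" "S \<in> A" "T \<in> A"
  shows "E (op_prod (us @ replicate k (op_add S T)))
    = E (op_prod (us @ replicate k S))
      + (\<Sum>a<k. E (op_prod (us @ replicate a S @ T # replicate (k - 1 - a) (op_add S T))))"
  using assms(1)
proof (induction k arbitrary: us)
  case (Suc k)
  have A: "set (replicate n (op_add S T)) \<subseteq> A" for n
    using assms by (auto simp: set_replicate_conv_if)
  have "E (op_prod (us @ replicate (Suc k) (op_add S T)))
      = E (op_prod ((us @ [S]) @ replicate k (op_add S T))) + E (op_prod (us @ T # replicate k (op_add S T)))"
    using E_op_prod_add[OF Suc.prems A assms(3,4), of k] by simp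
  moreover have "E (op_prod ((us @ [S]) @ replicate k (op_add S T)))
      = E (op_prod (us @ replicate (Suc k) S))
        + (\<Sum>a<k. E (op_prod (us @ replicate (Suc a) S @ T # replicate (k - 1 - a) (op_add S T))))"
    using Suc.IH[of "us @ [S]"] Suc.prems assms by simp
  ultimately show ?case by (simp add: sum.lessThan_Suc_shift del: sum.lessThan_Suc)
qed simp

text \<open>The definite description in \<open>spectral_measure\<close> calls for uniqueness: the
  masses of the intervals (a, b] determine the distribution function as a tends to minus
  infinity.\<close>

lemma spectral_measure_is_spectral_measure:
  assumes "X \<in> A" "self_adjoint X"
  shows "is_spectral_measure E X (spectral_measure E X)"
proof -
  have "M = M'" if "is_spectral_measure E X M" "is_spectral_measure E X M'" for M M' :: "real measure"
  proof -
    have rd: "real_distribution M" "real_distribution M'"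
      using that by (auto simp: is_spectral_measure_def real_distribution_def real_distribution_axioms_def)
    then interpret M: real_distribution M + M': real_distribution M' by simp_all
    have eq: "measure M {a<..b} = measure M' {a<..b}" if "a \<le> b" for a b
      using that \<open>is_spectral_measure E X M\<close> \<open>is_spectral_measure E X M'\<close>
      unfolding is_spectral_measure_def by (metis of_real_eq_iff)
    have "cdf M b = cdf M' b" for b
    proof -
      have lim: "((\<lambda>a. cdf M b - cdf M a) \<longlongrightarrow> cdf M b - 0) at_bot"
        by (intro tendsto_intros M.cdf_lim_at_bot)
      have lim': "((\<lambda>a. cdf M' b - cdf M' a) \<longlongrightarrow> cdf M' b - 0) at_bot"
        by (intro tendsto_intros M'.cdf_lim_at_bot)
      have "\<forall>\<^sub>F a in at_bot. cdf M b - cdf M a = cdf M' b - cdf M' a"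
        using eventually_gt_at_bot[of b]
        by eventually_elim (simp add: M.cdf_diff_eq M'.cdf_diff_eq eq)
      from tendsto_cong[OF this] lim have "((\<lambda>a. cdf M' b - cdf M' a) \<longlongrightarrow> cdf M b - 0) at_bot"
        by simp
      from tendsto_unique[OF _ this lim'] show ?thesis by simp
    qed
    then show ?thesis using cdf_unique[OF rd] by blast
  qed
  moreover obtain M where "is_spectral_measure E X M" using ex_spectral_measure[OF assms] by blast
  ultimately have "\<exists>!M. is_spectral_measure E X M" by blast
  then show ?thesis unfolding spectral_measure_def by (rule theI')
qed

lemma real_distribution_spectral_measure:
  assumes "X \<in> A" "self_adjoint X"
  shows "real_distribution (spectral_measure E X)"
  using spectral_measure_is_spectral_measure[OF assms]
  by (auto simp: is_spectral_measure_def real_distribution_def real_distribution_axioms_def)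

lemma E_op_prod_replicate:
  assumes "X \<in> A" "self_adjoint X"
  shows "E (op_prod (replicate k X)) = of_real (\<integral>t. t ^ k \<partial>spectral_measure E X)"
  using E_power[OF assms, of k] pow_eq_op_prod[OF assms(1), of k] by simp

end

section \<open>Noncommutative Lp norms and the expansion of powers of a sum\<close>

context nc_random_space
begin

text \<open>For self-adjoint \<open>X\<close> and even \<open>L\<close> > 0 this is the
  noncommutative Lp norm with p = L, written with the word \<open>X ^ L\<close> in place of the
  power of the absolute value.\<close>

definition Lnorm :: "nat \<Rightarrow> 'h oper \<Rightarrow> real" where
  "Lnorm L X = root L (cmod (E (op_prod (replicate L X))))"

lemma Lnorm_nonneg [simp]: "Lnorm L X \<ge> 0"
  by (cases "L = 0") (simp_all add: Lnorm_def)

lemma Lnorm_power: "L > 0 \<Longrightarrow> Lnorm L X ^ L = cmod (E (op_prod (replicate L X)))"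
  by (simp add: Lnorm_def)

lemma Lnorm_le:
  assumes "cmod (E (op_prod (replicate L X))) \<le> a ^ L" "a \<ge> 0" "L > 0"
  shows "Lnorm L X \<le> a"
  using real_root_le_mono[OF assms(3,1)] assms(2,3) by (simp add: Lnorm_def real_root_power_cancel)

text \<open>The alphabet of the chessboard argument is the finite set of letters of
  \<open>ws\<close>. The exponent \<open>length ws\<close> serves words of even length,
  \<open>2 * length ws\<close> those of any length.\<close>

lemma E_op_prod_Hoelder:
  assumes "set ws \<subseteq> A" "\<And>T. T \<in> set ws \<Longrightarrow> op_adj T = T"
    and "even L" "L > 0" "L = length ws \<or> L = 2 * length ws"
  shows "cmod (E (op_prod ws)) \<le> (\<Prod>T\<leftarrow>ws. Lnorm L T)"
proof -
  have cyc: "E (op_prod (us @ vs)) = E (op_prod (vs @ us))"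
    if "set us \<subseteq> set ws" "set vs \<subseteq> set ws" for us vs
    by (rule E_op_prod_cyclic) (use that assms(1) in auto)
  have cs: "(cmod (E (op_prod (us @ vs))))\<^sup>2
      \<le> cmod (E (op_prod (us @ rev us))) * cmod (E (op_prod (rev vs @ vs)))"
    if "set us \<subseteq> set ws" "set vs \<subseteq> set ws" for us vs
    by (rule E_op_prod_Cauchy_Schwarz) (use that assms(1,2) in auto)
  from assms(5) show ?thesis
  proof
    assume "L = length ws"
    then show ?thesis unfolding Lnorm_def
      by (intro chessboard_Hoelder[where \<tau> = "\<lambda>ws. E (op_prod ws)" and S = "set ws"])
         (use assms(3,4) in \<open>auto intro: cyc cs\<close>)
  next
    assume "L = 2 * length ws"
    then show ?thesis unfolding Lnorm_def
      by (intro chessboard_Hoelder_double[where \<tau> = "\<lambda>ws. E (op_prod ws)" and S = "set ws"])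
         (use E_one in \<open>auto intro: cyc cs\<close>)
  qed
qed

text \<open>Minkowski from Hoelder: one factor of (S + T)^L is split, both words are estimated, and
  the common power \<open>Lnorm L ?X ^ l\<close> is cancelled.\<close>

lemma Lnorm_triangle:
  assumes "S \<in> A" "T \<in> A" "op_adj S = S" "op_adj T = T" "even L" "L > 0"
  shows "Lnorm L (op_add S T) \<le> Lnorm L S + Lnorm L T"
proof -
  let ?X = "op_add S T"
  obtain l where L: "L = Suc l" using \<open>L > 0\<close> by (cases L) auto
  have X: "?X \<in> A" "op_adj ?X = ?X" using assms by (simp_all add: adj_add)
  have bound: "cmod (E (op_prod (Z # replicate l ?X))) \<le> Lnorm L Z * Lnorm L ?X ^ l"
    if "Z \<in> A" "op_adj Z = Z" for Z
  proof -
    have "set (Z # replicate l ?X) \<subseteq> A" "\<And>U. U \<in> set (Z # replicate l ?X) \<Longrightarrow> op_adj U = U"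
      using X that by (auto simp: set_replicate_conv_if split: if_splits)
    from E_op_prod_Hoelder[OF this assms(5,6)] show ?thesis by (simp add: L)
  qed
  have "E (op_prod (?X # replicate l ?X)) = E (op_prod (S # replicate l ?X)) + E (op_prod (T # replicate l ?X))"
    using E_op_prod_add[of "[]" "replicate l ?X" S T] assms by (simp add: set_replicate_conv_if)
  then have "Lnorm L ?X ^ L \<le> cmod (E (op_prod (S # replicate l ?X))) + cmod (E (op_prod (T # replicate l ?X)))"
    unfolding Lnorm_power[OF \<open>L > 0\<close>] by (simp add: L norm_triangle_ineq)
  also have "\<dots> \<le> (Lnorm L S + Lnorm L T) * Lnorm L ?X ^ l"
    using bound[of S] bound[of T] assms by (simp add: distrib_right)
  finally have "Lnorm L ?X * Lnorm L ?X ^ l \<le> (Lnorm L S + Lnorm L T) * Lnorm L ?X ^ l"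
    by (simp add: L)
  note le = this
  show ?thesis
  proof (cases "Lnorm L ?X = 0")
    case False
    then have "Lnorm L ?X ^ l > 0" using Lnorm_nonneg[of L ?X] by (intro zero_less_power) linarith
    with le show ?thesis by (rule mult_right_le_imp_le)
  qed simp
qed

text \<open>The telescoping identity is applied to its own tails. The exponents keep the nested form
  in which repeated telescoping yields them.\<close>

lemma E_power_add_expand2:
  assumes "S \<in> A" "T \<in> A"
  defines "X \<equiv> op_add S T"
  shows "E (op_prod (replicate k X)) = E (op_prod (replicate k S))
    + (\<Sum>a<k. E (op_prod (replicate a S @ T # replicate (k - 1 - a) S)))
    + (\<Sum>a<k. \<Sum>b<k - 1 - a.
        E (op_prod (replicate a S @ T # replicate b S @ T # replicate (k - 1 - a - 1 - b) X)))"
proof -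
  have A: "set (replicate n S) \<subseteq> A" for n using assms by (auto simp: set_replicate_conv_if)
  have "E (op_prod (replicate a S @ T # replicate n X)) = E (op_prod (replicate a S @ T # replicate n S))
      + (\<Sum>b<n. E (op_prod (replicate a S @ T # replicate b S @ T # replicate (n - 1 - b) X)))" for a n
    using E_op_prod_telescope[of "replicate a S @ [T]" "[]" S T n] assms A by simp
  then show ?thesis
    using E_op_prod_telescope[of "[]" "[]" S T k] assms by (simp add: sum.distrib)
qed

lemma E_power_add_expand3:
  assumes "S \<in> A" "T \<in> A"
  defines "X \<equiv> op_add S T"
  shows "E (op_prod (replicate k X)) = E (op_prod (replicate k S))
    + (\<Sum>a<k. E (op_prod (replicate a S @ T # replicate (k - 1 - a) S)))
    + (\<Sum>a<k. \<Sum>b<k - 1 - a.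
        E (op_prod (replicate a S @ T # replicate b S @ T # replicate (k - 1 - a - 1 - b) S)))
    + (\<Sum>a<k. \<Sum>b<k - 1 - a. \<Sum>c<k - 1 - a - 1 - b.
        E (op_prod (replicate a S @ T # replicate b S @ T # replicate c S @ T
          # replicate (k - 1 - a - 1 - b - 1 - c) X)))"
proof -
  have A: "set (replicate n S) \<subseteq> A" for n using assms by (auto simp: set_replicate_conv_if)
  have "E (op_prod (replicate a S @ T # replicate b S @ T # replicate n X))
      = E (op_prod (replicate a S @ T # replicate b S @ T # replicate n S))
      + (\<Sum>c<n. E (op_prod (replicate a S @ T # replicate b S @ T # replicate c S @ T # replicate (n - 1 - c) X)))"
    for a b n
    using E_op_prod_telescope[of "replicate a S @ T # replicate b S @ [T]" "[]" S T n] assms A by simp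
  then show ?thesis
    using E_power_add_expand2[of S T k] assms by (simp add: sum.distrib)
qed

end

section \<open>Sequences satisfying Condition A\<close>

lemma sum_lists_Suc:
  assumes "finite I"
  shows "(\<Sum>is\<in>{is. set is \<subseteq> I \<and> length is = Suc b}. f is)
       = (\<Sum>i\<in>I. \<Sum>is\<in>{is. set is \<subseteq> I \<and> length is = b}. f (i # is))"
proof -
  have "(\<Sum>is\<in>{is. set is \<subseteq> I \<and> length is = Suc b}. f is)
      = (\<Sum>(i, is)\<in>I \<times> {is. set is \<subseteq> I \<and> length is = b}. f (i # is))"
    by (rule sum.reindex_bij_witness[where i = "\<lambda>(i, is). i # is" and j = "\<lambda>is. (hd is, tl is)"])
       (auto simp: length_Suc_conv)
  also have "\<dots> = (\<Sum>i\<in>I. \<Sum>is\<in>{is. set is \<subseteq> I \<and> length is = b}. f (i # is))"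
    by (subst sum.cartesian_product) simp
  finally show ?thesis .
qed

lemma (in operator_algebra) op_prod_replicate_zero:
  "k > 0 \<Longrightarrow> op_prod (replicate k (op_zero :: 'h oper)) = op_zero"
  using R.l_null[of "op_prod (replicate (k - 1) op_zero)"]
  by (cases k) (simp_all add: set_replicate_conv_if)

locale condition_A_sequence = nc_random_space A E
  for A :: "'h::complex_hilbert oper set" and E +
  fixes \<xi> :: "nat \<Rightarrow> 'h oper"
  assumes \<xi>_in: "\<And>i. i \<ge> 1 \<Longrightarrow> \<xi> i \<in> A"
    and \<xi>_self_adjoint: "\<And>i. i \<ge> 1 \<Longrightarrow> self_adjoint (\<xi> i)"
    and cond_A: "condition_A E \<xi>"
begin

definition T :: "nat \<Rightarrow> 'h oper" where
  "T n = (\<Oplus>\<^bsub>op_ring A\<^esub>i\<in>{1..n}. \<xi> i)"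

lemma T_0: "T 0 = op_zero" by (simp add: T_def)

lemma T_in [simp]: "T n \<in> A"
  using R.finsum_closed[of \<xi> "{1..n}"] \<xi>_in by (auto simp: T_def)

lemma T_Suc: "T (Suc n) = op_add (T n) (\<xi> (Suc n))"
proof -
  have "{1..Suc n} = insert (Suc n) {1..n}" by auto
  then have "T (Suc n) = op_add (\<xi> (Suc n)) (T n)"
    using R.finsum_insert[of "{1..n}" "Suc n" \<xi>] \<xi>_in by (simp add: T_def Pi_def)
  then show ?thesis
    using R.a_comm[of "\<xi> (Suc n)" "T n"] \<xi>_in[of "Suc n"] by simp
qed

lemma op_adj_\<xi>: "i \<ge> 1 \<Longrightarrow> op_adj (\<xi> i) = \<xi> i"
  using \<xi>_self_adjoint by (simp add: self_adjoint_def)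

lemma op_adj_T [simp]: "op_adj (T n) = T n"
  by (induction n) (simp_all add: T_0 T_Suc adj_add op_adj_\<xi> \<xi>_in)

lemma set_map_\<xi>: "set is \<subseteq> {1..} \<Longrightarrow> set (map \<xi> is) \<subseteq> A"
  using \<xi>_in by auto

lemma E_op_prod_T:
  assumes "set us \<subseteq> A" "set vs \<subseteq> A"
  shows "E (op_prod (us @ T n # vs)) = (\<Sum>i=1..n. E (op_prod (us @ \<xi> i # vs)))"
proof (induction n)
  case 0
  have "op_mult op_zero (op_prod vs) = op_zero" "op_mult (op_prod us) op_zero = op_zero"
    using R.l_null[of "op_prod vs"] R.r_null[of "op_prod us"] assms by simp_all
  then show ?case using assms by (simp add: T_0 op_prod_append)
next
  case (Suc n)
  then show ?case
    using E_op_prod_add[OF assms T_in[of n] \<xi>_in[of "Suc n"]] by (simp add: T_Suc)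
qed

text \<open>Condition A speaks of words in the \<open>\<xi> i\<close>, so powers of
  \<open>T n\<close> inside a longer word have to be resolved into such words before it
  applies.\<close>

lemma E_op_prod_T_power:
  assumes "set us \<subseteq> A" "set vs \<subseteq> A"
  shows "E (op_prod (us @ replicate b (T n) @ vs))
    = (\<Sum>is\<in>{is. set is \<subseteq> {1..n} \<and> length is = b}. E (op_prod (us @ map \<xi> is @ vs)))"
  using assms(1)
proof (induction b arbitrary: us)
  case 0
  have "{is. set is \<subseteq> {1..n} \<and> length is = 0} = {[]}" by auto
  then show ?case by simp
next
  case (Suc b)
  have "set (replicate b (T n) @ vs) \<subseteq> A" using assms by (auto simp: set_replicate_conv_if)
  from E_op_prod_T[OF Suc.prems this]
  have "E (op_prod (us @ replicate (Suc b) (T n) @ vs))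
      = (\<Sum>i=1..n. E (op_prod ((us @ [\<xi> i]) @ replicate b (T n) @ vs)))" by simp
  also have "\<dots> = (\<Sum>i=1..n. \<Sum>is\<in>{is. set is \<subseteq> {1..n} \<and> length is = b}.
      E (op_prod ((us @ [\<xi> i]) @ map \<xi> is @ vs)))"
    by (intro sum.cong refl Suc.IH) (use Suc.prems \<xi>_in in auto)
  finally show ?case by (simp add: sum_lists_Suc)
qed

lemma E_first_order: "E (op_prod (\<xi> (Suc n) # replicate b (T n))) = 0"
proof -
  have "E (op_prod (\<xi> (Suc n) # map \<xi> is)) = 0" if "set is \<subseteq> {1..n}" for "is"
  proof -
    have "set is \<subseteq> {1..} - {Suc n}" using that by auto
    then show ?thesis using cond_A by (auto simp: condition_A_def op_word_eq_op_prod)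
  qed
  then show ?thesis
    using E_op_prod_T_power[of "[\<xi> (Suc n)]" "[]" b n] \<xi>_in[of "Suc n"] by simp
qed

lemma E_second_order_words:
  assumes "set is \<subseteq> {1..n}" "set js \<subseteq> {1..n}"
  shows "E (op_prod (\<xi> (Suc n) # map \<xi> is @ \<xi> (Suc n) # map \<xi> js))
    = E (op_mult (\<xi> (Suc n)) (\<xi> (Suc n))) * E (op_prod (map \<xi> is)) * E (op_prod (map \<xi> js))"
\<comment> \<open>The factorization clause of Condition A starts at index 2. For index 1 both inner
  words are empty, and \<open>E Id = 1\<close> gives the claim.\<close>
proof (cases "n = 0")
  case True
  then show ?thesis using assms \<xi>_in[of 1] by (simp add: E_one)
next
  case False
  have A: "set (map \<xi> is) \<subseteq> A" "set (map \<xi> js) \<subseteq> A"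
    using assms by (intro set_map_\<xi>; auto)+
  have "set is \<subseteq> {1..<Suc n}" "set js \<subseteq> {1..<Suc n}" "Suc n \<ge> 2" using assms False by auto
  with cond_A have "E (op_mult (\<xi> (Suc n)) (op_mult (op_word \<xi> is) (op_mult (\<xi> (Suc n)) (op_word \<xi> js))))
      = E (op_mult (\<xi> (Suc n)) (\<xi> (Suc n))) * E (op_word \<xi> is) * E (op_word \<xi> js)"
    unfolding condition_A_def by blast
  then show ?thesis
    using A \<xi>_in[of "Suc n"] by (simp add: op_word_eq_op_prod op_prod_append)
qed

lemma E_second_order:
  "E (op_prod (\<xi> (Suc n) # replicate b (T n) @ \<xi> (Suc n) # replicate c (T n)))
    = E (op_mult (\<xi> (Suc n)) (\<xi> (Suc n))) * E (op_prod (replicate b (T n))) * E (op_prod (replicate c (T n)))"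
proof -
  let ?W = "\<lambda>b. {is. set is \<subseteq> {1..n} \<and> length is = b}"
  let ?x = "\<xi> (Suc n)"
  have x: "?x \<in> A" by (simp add: \<xi>_in)
  have T: "set (replicate c (T n)) \<subseteq> A" for c by (simp add: set_replicate_conv_if)
  have words: "E (op_prod (replicate b (T n))) = (\<Sum>is\<in>?W b. E (op_prod (map \<xi> is)))" for b
    using E_op_prod_T_power[of "[]" "[]" b n] by simp
  have "E (op_prod (?x # replicate b (T n) @ ?x # replicate c (T n)))
      = (\<Sum>is\<in>?W b. E (op_prod (?x # map \<xi> is @ ?x # replicate c (T n))))"
    using E_op_prod_T_power[of "[?x]" "?x # replicate c (T n)" b n] x T by simp
  also have "\<dots> = (\<Sum>is\<in>?W b. \<Sum>js\<in>?W c. E (op_prod (?x # map \<xi> is @ ?x # map \<xi> js)))"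
  proof (intro sum.cong refl)
    fix "is" assume "is \<in> ?W b"
    then have "set (map \<xi> is) \<subseteq> A" by (intro set_map_\<xi>) auto
    then show "E (op_prod (?x # map \<xi> is @ ?x # replicate c (T n)))
        = (\<Sum>js\<in>?W c. E (op_prod (?x # map \<xi> is @ ?x # map \<xi> js)))"
      using E_op_prod_T_power[of "?x # map \<xi> is @ [?x]" "[]" c n] x by simp
  qed
  also have "\<dots> = (\<Sum>is\<in>?W b. \<Sum>js\<in>?W c. E (op_mult ?x ?x) * E (op_prod (map \<xi> is)) * E (op_prod (map \<xi> js)))"
    by (intro sum.cong refl E_second_order_words) auto
  also have "\<dots> = E (op_mult ?x ?x) * (\<Sum>is\<in>?W b. E (op_prod (map \<xi> is))) * (\<Sum>js\<in>?W c. E (op_prod (map \<xi> js)))"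
    by (simp only: mult.assoc sum_product) (simp only: sum_distrib_left)
  finally show ?thesis unfolding words .
qed

text \<open>The trace rotates the initial block of a letters \<open>X\<close> to the end. Words with
  one \<open>Y\<close> then vanish, and those with two have gaps b and k - 2 - b whatever a is. The
  version with an unexpanded tail after two \<open>Y\<close> serves the growth bound, the other one
  the moment recursion.\<close>

lemma E_power_Suc:
  fixes n :: nat
  defines "X \<equiv> T n" and "Y \<equiv> \<xi> (Suc n)" and "Z \<equiv> T (Suc n)"
  shows E_power_Suc2: "E (op_prod (replicate k Z)) = E (op_prod (replicate k X))
      + (\<Sum>a<k. \<Sum>b<k - 1 - a.
          E (op_prod (replicate a X @ Y # replicate b X @ Y # replicate (k - 1 - a - 1 - b) Z)))"
    and E_power_Suc3: "E (op_prod (replicate k Z)) = E (op_prod (replicate k X))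
      + E (op_mult Y Y) * (\<Sum>a<k. \<Sum>b<k - 1 - a.
          E (op_prod (replicate b X)) * E (op_prod (replicate (k - 2 - b) X)))
      + (\<Sum>a<k. \<Sum>b<k - 1 - a. \<Sum>c<k - 1 - a - 1 - b.
          E (op_prod (replicate a X @ Y # replicate b X @ Y # replicate c X @ Y
            # replicate (k - 1 - a - 1 - b - 1 - c) Z)))"
proof -
  have in_A: "X \<in> A" "Y \<in> A" "Z = op_add X Y"
    by (simp_all add: X_def Y_def Z_def \<xi>_in T_Suc)
  have rX: "set (replicate n X) \<subseteq> A" for n using in_A by (simp add: set_replicate_conv_if)
  have first: "E (op_prod (replicate a X @ Y # replicate b X)) = 0" for a b
    using E_op_prod_cyclic[of "replicate a X" "Y # replicate b X"] rX in_A(2)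
      E_first_order[of n "b + a"]
    by (simp add: X_def Y_def replicate_add)
  have second: "E (op_prod (replicate a X @ Y # replicate b X @ Y # replicate (k - 1 - a - 1 - b) X))
      = E (op_mult Y Y) * (E (op_prod (replicate b X)) * E (op_prod (replicate (k - 2 - b) X)))"
    if "a < k" "b < k - 1 - a" for a b
  proof -
    have "E (op_prod (replicate a X @ Y # replicate b X @ Y # replicate (k - 1 - a - 1 - b) X))
        = E (op_prod (Y # replicate b X @ Y # replicate (k - 1 - a - 1 - b + a) X))"
      using E_op_prod_cyclic[of "replicate a X" "Y # replicate b X @ Y # replicate (k - 1 - a - 1 - b) X"]
        rX in_A(2) by (simp add: replicate_add)
    also have "k - 1 - a - 1 - b + a = k - 2 - b" using that by simp
    finally show ?thesis using E_second_order[of n] by (simp add: X_def Y_def mult.assoc)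
  qed
  show "E (op_prod (replicate k Z)) = E (op_prod (replicate k X))
      + (\<Sum>a<k. \<Sum>b<k - 1 - a.
          E (op_prod (replicate a X @ Y # replicate b X @ Y # replicate (k - 1 - a - 1 - b) Z)))"
    using E_power_add_expand2[OF in_A(1,2), of k] first by (simp add: in_A(3))
  have "(\<Sum>a<k. \<Sum>b<k - 1 - a.
        E (op_prod (replicate a X @ Y # replicate b X @ Y # replicate (k - 1 - a - 1 - b) X)))
      = E (op_mult Y Y) * (\<Sum>a<k. \<Sum>b<k - 1 - a.
          E (op_prod (replicate b X)) * E (op_prod (replicate (k - 2 - b) X)))"
    unfolding sum_distrib_left by (intro sum.cong refl second) auto
  then show "E (op_prod (replicate k Z)) = E (op_prod (replicate k X))
      + E (op_mult Y Y) * (\<Sum>a<k. \<Sum>b<k - 1 - a.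
          E (op_prod (replicate b X)) * E (op_prod (replicate (k - 2 - b) X)))
      + (\<Sum>a<k. \<Sum>b<k - 1 - a. \<Sum>c<k - 1 - a - 1 - b.
          E (op_prod (replicate a X @ Y # replicate b X @ Y # replicate c X @ Y
            # replicate (k - 1 - a - 1 - b - 1 - c) Z)))"
    using E_power_add_expand3[OF in_A(1,2), of k] first by (simp add: in_A(3))
qed

end

section \<open>Growth of the partial sums and the remainder of the recursion\<close>

lemma norm_sum_le_bound:
  fixes f :: "nat \<Rightarrow> 'a::real_normed_vector"
  assumes "\<And>i. i < n \<Longrightarrow> norm (f i) \<le> K" "n \<le> k" "K \<ge> 0"
  shows "norm (\<Sum>i<n. f i) \<le> real k * K"
proof -
  have "norm (\<Sum>i<n. f i) \<le> real n * K"
    using sum_norm_bound[of "{..<n}" f K] assms(1) by simp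
  also have "\<dots> \<le> real k * K" using assms(2,3) by (intro mult_right_mono) auto
  finally show ?thesis .
qed

context condition_A_sequence
begin

text \<open>With x the square of the bound for \<open>T n\<close> and D the coefficient of
  \<open>real n + 1\<close>, the second-order expansion gives Lnorm^L \<le> x^(L/2) + D * x^(L/2 -
  1) \<le> (x + D)^(L/2), so each step adds at most D under the root. In D, L^2 bounds the number of
  words, \<beta>^2 comes from the two new factors and 2^L from the crude bounds on the
  others.\<close>

lemma Lnorm_T_bound:
  fixes \<beta> :: real
  assumes L: "even L" "L > 0" and \<beta>: "\<beta> \<ge> 1" "\<And>i. i \<ge> 1 \<Longrightarrow> Lnorm L (\<xi> i) \<le> \<beta>"
  shows "Lnorm L (T n) \<le> sqrt (real L ^ 2 * \<beta>\<^sup>2 * 2 ^ L * (real n + 1))"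
proof (induction n)
  case 0
  have "Lnorm L (T 0) = 0" using L by (simp add: Lnorm_def T_0 op_prod_replicate_zero)
  then show ?case by simp
next
  case (Suc n)
  define D where "D = real L ^ 2 * \<beta>\<^sup>2 * 2 ^ L"
  define x where "x = D * (real n + 1)"
  define \<alpha> where "\<alpha> = sqrt x"
  let ?X = "T n" and ?Y = "\<xi> (Suc n)" and ?Z = "T (Suc n)"
  obtain q where q: "L = 2 * (q + 1)"
    using L by (metis Suc_eq_plus1 dvd_def gr0_implies_Suc mult_0_right neq0_conv)
  have "1 * \<beta>\<^sup>2 * 1 \<le> real L ^ 2 * \<beta>\<^sup>2 * 2 ^ L"
    using L by (intro mult_mono) (auto simp: one_le_power)
  then have D: "\<beta>\<^sup>2 \<le> D" by (simp add: D_def)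
  moreover have "0 \<le> D" by (simp add: D_def)
  ultimately have "\<beta>\<^sup>2 \<le> x" "x \<ge> 0" by (simp_all add: x_def algebra_simps add_increasing2)
  then have \<alpha>: "\<beta> \<le> \<alpha>" unfolding \<alpha>_def by (intro real_le_rsqrt)
  have X: "Lnorm L ?X \<le> \<alpha>" using Suc.IH by (simp add: \<alpha>_def x_def D_def)
  have Y: "Lnorm L ?Y \<le> \<beta>" using \<beta> by simp
  \<comment> \<open>The tails of the words contain \<open>T (Suc n)\<close>, the operator to be
    bounded. The triangle inequality loses a factor 2 here, which affects only the constant.\<close>
  have Z: "Lnorm L ?Z \<le> 2 * \<alpha>"
    using Lnorm_triangle[OF T_in[of n] \<xi>_in[of "Suc n"] _ _ L] X Y \<alpha> by (simp add: T_Suc op_adj_\<xi>)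
  have X': "Lnorm L ?X \<le> 2 * \<alpha>" using X \<alpha> \<beta> by linarith
  have \<alpha>0: "\<alpha> \<ge> 0" using \<alpha> \<beta> by linarith
  define K where "K = \<beta>\<^sup>2 * (2 * \<alpha>) ^ (L - 2)"
  have K0: "K \<ge> 0" using \<alpha>0 by (simp add: K_def)
  have word_le: "cmod (E (op_prod (replicate a ?X @ ?Y # replicate b ?X @ ?Y # replicate (L - 1 - a - 1 - b) ?Z))) \<le> K"
    if "a < L" "b < L - 1 - a" for a b
  proof -
    let ?w = "replicate a ?X @ ?Y # replicate b ?X @ ?Y # replicate (L - 1 - a - 1 - b) ?Z"
    have "set ?w \<subseteq> A" "\<And>U. U \<in> set ?w \<Longrightarrow> op_adj U = U"
      using \<xi>_in[of "Suc n"] op_adj_\<xi>[of "Suc n"] by (auto simp: set_replicate_conv_if split: if_splits)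
    note A = this
    have len: "L = length ?w" using that by simp
    have "cmod (E (op_prod ?w)) \<le> (\<Prod>U\<leftarrow>?w. Lnorm L U)"
      by (rule E_op_prod_Hoelder[OF A L disjI1[OF len]])
    also have "\<dots> = Lnorm L ?X ^ a * (Lnorm L ?Y * (Lnorm L ?X ^ b * (Lnorm L ?Y * Lnorm L ?Z ^ (L - 1 - a - 1 - b))))"
      by simp
    also have "\<dots> \<le> (2 * \<alpha>) ^ a * (\<beta> * ((2 * \<alpha>) ^ b * (\<beta> * (2 * \<alpha>) ^ (L - 1 - a - 1 - b))))"
      using \<alpha>0 \<beta>(1) by (intro mult_mono power_mono X' Y Z) auto
    also have "\<dots> = \<beta>\<^sup>2 * (2 * \<alpha>) ^ (a + b + (L - 1 - a - 1 - b))"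
      by (simp only: power_add power2_eq_square mult_ac)
    also have "a + b + (L - 1 - a - 1 - b) = L - 2" using that by simp
    finally show ?thesis by (simp add: K_def)
  qed
  have "cmod (E (op_prod (replicate L ?Z))) \<le> cmod (E (op_prod (replicate L ?X))) + real L * (real L * K)"
    unfolding E_power_Suc2
    by (intro order.trans[OF norm_triangle_ineq] add_left_mono norm_sum_le_bound word_le mult_nonneg_nonneg K0) auto
  also have "cmod (E (op_prod (replicate L ?X))) \<le> \<alpha> ^ L"
    using Lnorm_power[OF L(2), of ?X] power_mono[OF X, of L] by simp
  also have "real L * (real L * K) \<le> D * \<alpha> ^ (L - 2)"
  proof -
    have "(2 * \<alpha>) ^ (L - 2) \<le> 2 ^ L * \<alpha> ^ (L - 2)"
      unfolding power_mult_distrib using \<alpha>0 by (intro mult_right_mono power_increasing) auto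
    then have "real L ^ 2 * \<beta>\<^sup>2 * (2 * \<alpha>) ^ (L - 2) \<le> real L ^ 2 * \<beta>\<^sup>2 * (2 ^ L * \<alpha> ^ (L - 2))"
      by (intro mult_left_mono) auto
    then show ?thesis by (simp only: K_def D_def power2_eq_square mult_ac)
  qed
  also have "\<alpha> ^ L + D * \<alpha> ^ (L - 2) = x ^ (q + 1) + D * x ^ q"
    using \<open>x \<ge> 0\<close> by (simp add: \<alpha>_def q power_mult flip: real_sqrt_power)
  also have "\<dots> = (x + D) * x ^ q" by (simp add: algebra_simps)
  also have "\<dots> \<le> (x + D) * (x + D) ^ q"
    using \<open>x \<ge> 0\<close> \<open>0 \<le> D\<close> by (intro mult_left_mono power_mono) auto
  also have "\<dots> = sqrt (x + D) ^ L"
    using \<open>x \<ge> 0\<close> \<open>0 \<le> D\<close> by (simp add: q power_mult)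
  finally have "Lnorm L ?Z \<le> sqrt (x + D)"
    using \<open>x \<ge> 0\<close> \<open>0 \<le> D\<close> L by (intro Lnorm_le) simp_all
  then show ?case by (simp add: x_def D_def algebra_simps)
qed

text \<open>Hoelder's inequality with exponent 2 * k also serves odd \<open>k\<close>. Each of at
  most k^3 words has three factors of norm at most \<beta> and k - 3 factors of norm O(sqrt
  n).\<close>

lemma E_third_order_remainder:
  fixes \<beta> :: real
  assumes k: "k > 0" and \<beta>: "\<beta> \<ge> 1" "\<And>i. i \<ge> 1 \<Longrightarrow> Lnorm (2 * k) (\<xi> i) \<le> \<beta>"
  shows "\<exists>C. \<forall>n. cmod (E (op_prod (replicate k (T (Suc n)))) - E (op_prod (replicate k (T n)))
      - E (op_mult (\<xi> (Suc n)) (\<xi> (Suc n))) * (\<Sum>a<k. \<Sum>b<k - 1 - a.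
          E (op_prod (replicate b (T n))) * E (op_prod (replicate (k - 2 - b) (T n)))))
      \<le> C * sqrt (real n + 1) ^ (k - 3)"
proof -
  define L where "L = 2 * k"
  have L: "even L" "L > 0" using k by (simp_all add: L_def)
  define D where "D = real L ^ 2 * \<beta>\<^sup>2 * 2 ^ L"
  have bound: "Lnorm L (T n) \<le> sqrt (D * (real n + 1))" for n
    using Lnorm_T_bound[OF L \<beta>(1)] \<beta>(2) by (simp add: D_def L_def)
  define \<gamma> where "\<gamma> n = sqrt (D * (real n + 1)) + \<beta>" for n
  have \<gamma>: "\<gamma> n \<le> (sqrt D + \<beta>) * sqrt (real n + 1)" "\<gamma> n \<ge> 0" for n
  proof -
    have "\<beta> * 1 \<le> \<beta> * sqrt (real n + 1)" using \<beta>(1) by (intro mult_left_mono) auto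
    then show "\<gamma> n \<le> (sqrt D + \<beta>) * sqrt (real n + 1)"
      unfolding \<gamma>_def real_sqrt_mult distrib_right by simp
    show "\<gamma> n \<ge> 0" using \<beta>(1) by (simp add: \<gamma>_def D_def)
  qed
  define C where "C = real k * (real k * (real k * (\<beta> ^ 3 * (sqrt D + \<beta>) ^ (k - 3))))"
  have "cmod (\<Sum>a<k. \<Sum>b<k - 1 - a. \<Sum>c<k - 1 - a - 1 - b.
          E (op_prod (replicate a (T n) @ \<xi> (Suc n) # replicate b (T n) @ \<xi> (Suc n)
            # replicate c (T n) @ \<xi> (Suc n) # replicate (k - 1 - a - 1 - b - 1 - c) (T (Suc n)))))
      \<le> C * sqrt (real n + 1) ^ (k - 3)" for n
  proof -
    let ?X = "T n" and ?Y = "\<xi> (Suc n)" and ?Z = "T (Suc n)"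
    have Y: "Lnorm L ?Y \<le> \<beta>" using \<beta> by (simp add: L_def)
    have Z: "Lnorm L ?Z \<le> \<gamma> n"
      using Lnorm_triangle[OF T_in[of n] \<xi>_in[of "Suc n"] _ _ L] bound[of n] Y
      by (simp add: T_Suc op_adj_\<xi> \<gamma>_def)
    have X: "Lnorm L ?X \<le> \<gamma> n" using bound[of n] \<beta>(1) by (simp add: \<gamma>_def)
    define K where "K = \<beta> ^ 3 * \<gamma> n ^ (k - 3)"
    have K0: "K \<ge> 0" using \<gamma>(2) \<beta>(1) by (simp add: K_def)
    have word_le: "cmod (E (op_prod (replicate a ?X @ ?Y # replicate b ?X @ ?Y # replicate c ?X @ ?Y
        # replicate (k - 1 - a - 1 - b - 1 - c) ?Z))) \<le> K"
      if "a < k" "b < k - 1 - a" "c < k - 1 - a - 1 - b" for a b c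
    proof -
      define d where "d = k - 1 - a - 1 - b - 1 - c"
      let ?w = "replicate a ?X @ ?Y # replicate b ?X @ ?Y # replicate c ?X @ ?Y # replicate d ?Z"
      have A: "set ?w \<subseteq> A" "\<And>U. U \<in> set ?w \<Longrightarrow> op_adj U = U"
        using \<xi>_in[of "Suc n"] op_adj_\<xi>[of "Suc n"]
        by (auto simp: set_replicate_conv_if split: if_splits)
      have len: "L = 2 * length ?w" using that by (simp add: L_def d_def)
      have "cmod (E (op_prod ?w)) \<le> (\<Prod>U\<leftarrow>?w. Lnorm L U)"
        by (rule E_op_prod_Hoelder[OF A L disjI2[OF len]])
      also have "\<dots> = Lnorm L ?X ^ a * (Lnorm L ?Y * (Lnorm L ?X ^ b * (Lnorm L ?Y
          * (Lnorm L ?X ^ c * (Lnorm L ?Y * Lnorm L ?Z ^ d)))))" by simp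
      also have "\<dots> \<le> \<gamma> n ^ a * (\<beta> * (\<gamma> n ^ b * (\<beta> * (\<gamma> n ^ c * (\<beta> * \<gamma> n ^ d)))))"
        using \<gamma>(2)[of n] \<beta>(1) by (intro mult_mono power_mono X Y Z) auto
      also have "\<dots> = \<beta> ^ 3 * \<gamma> n ^ (a + b + c + d)"
        by (simp only: power_add power3_eq_cube mult_ac)
      also have "a + b + c + d = k - 3" using that by (simp add: d_def)
      finally show ?thesis by (simp add: K_def d_def)
    qed
    have "cmod (\<Sum>a<k. \<Sum>b<k - 1 - a. \<Sum>c<k - 1 - a - 1 - b.
          E (op_prod (replicate a ?X @ ?Y # replicate b ?X @ ?Y # replicate c ?X @ ?Y
            # replicate (k - 1 - a - 1 - b - 1 - c) ?Z))) \<le> real k * (real k * (real k * K))"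
      by (intro norm_sum_le_bound word_le mult_nonneg_nonneg K0) auto
    also have "\<dots> \<le> real k * (real k * (real k * (\<beta> ^ 3 * ((sqrt D + \<beta>) * sqrt (real n + 1)) ^ (k - 3))))"
      unfolding K_def using \<beta>(1) by (intro mult_left_mono power_mono \<gamma>) auto
    also have "\<dots> = C * sqrt (real n + 1) ^ (k - 3)"
      by (simp only: C_def power_mult_distrib mult.assoc)
    finally show ?thesis .
  qed
  then show ?thesis
    unfolding E_power_Suc3[of k] by (intro exI[of _ C]) (simp add: algebra_simps)
qed

end

section \<open>Passage to the limit\<close>

interpretation semicircle: semicircle_moments "\<lambda>k. \<integral>x. x ^ k \<partial>semicircle_measure"
  by unfold_locales (fact semicircle_moment_0 semicircle_moment_1 semicircle_moment_rec)+

text \<open>The bound 4^k on the even moments leaves terms of the exponential series at 2 *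
  t.\<close>

lemma semicircle_moment_growth:
  "(\<lambda>k. t ^ (2 * k) * (\<integral>x. x ^ (2 * k) \<partial>semicircle_measure) / fact (2 * k)) \<longlonglongrightarrow> 0"
proof (rule tendsto_sandwich)
  have nn: "(\<integral>x. x ^ (2 * k) \<partial>semicircle_measure) \<in> {0..4 ^ k}" for k
    by (rule semicircle.even_bounds)
  show "\<forall>\<^sub>F k in sequentially.
      0 \<le> t ^ (2 * k) * (\<integral>x. x ^ (2 * k) \<partial>semicircle_measure) / fact (2 * k)"
    using nn by (intro always_eventually allI divide_nonneg_nonneg mult_nonneg_nonneg) auto
  show "\<forall>\<^sub>F k in sequentially. t ^ (2 * k) * (\<integral>x. x ^ (2 * k) \<partial>semicircle_measure) / fact (2 * k)
      \<le> (2 * t) ^ (2 * k) / fact (2 * k)"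
  proof (intro always_eventually allI divide_right_mono)
    fix k
    have "t ^ (2 * k) * (\<integral>x. x ^ (2 * k) \<partial>semicircle_measure) \<le> t ^ (2 * k) * 4 ^ k"
      using nn by (intro mult_left_mono) auto
    also have "\<dots> = (2 * t) ^ (2 * k)" by (simp add: power_mult power_mult_distrib)
    finally show "t ^ (2 * k) * (\<integral>x. x ^ (2 * k) \<partial>semicircle_measure) \<le> (2 * t) ^ (2 * k)" .
  qed simp
  show "(\<lambda>k. (2 * t) ^ (2 * k) / fact (2 * k)) \<longlonglongrightarrow> 0" by (rule power_over_fact_even)
qed simp

context condition_A_sequence
begin

lemma self_adjoint_scale_T: "self_adjoint (op_scale (of_real c) (T n))"
  using closed_operator[OF scale_closed[OF T_in]] by (simp add: self_adjoint_def adj_scale)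

lemma self_adjoint_T: "self_adjoint (T n)"
  using closed_operator[OF T_in] by (simp add: self_adjoint_def)

definition m :: "nat \<Rightarrow> nat \<Rightarrow> real" where
  "m k n = (\<integral>t. t ^ k \<partial>spectral_measure E (T n))"

lemma E_T_power: "E (op_prod (replicate k (T n))) = of_real (m k n)"
  unfolding m_def by (rule E_op_prod_replicate[OF T_in self_adjoint_T])

lemma moment_scale_T:
  "(\<integral>t. t ^ k \<partial>spectral_measure E (op_scale (of_real c) (T n))) = c ^ k * m k n"
proof -
  have "T n \<in> A" "op_prod (replicate k (T n)) \<in> A" by (auto simp: set_replicate_conv_if)
  then have "complex_of_real (\<integral>t. t ^ k \<partial>spectral_measure E (op_scale (of_real c) (T n)))
      = complex_of_real (c ^ k * m k n)"
    using E_op_prod_replicate[OF scale_closed[OF T_in] self_adjoint_scale_T, of k c n]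
    by (simp add: op_prod_replicate_scale E_scale E_T_power)
  then show ?thesis by (simp only: of_real_eq_iff)
qed

text \<open>For even \<open>L\<close> the absolute moment and the moment are the same integral.
  Since \<open>\<beta> \<ge> 1\<close>, the bound \<beta> may be weakened to \<beta>^L, which avoids
  taking a root.\<close>

lemma Lnorm_le_of_abs_moment:
  assumes "X \<in> A" "self_adjoint X" "even L" "L > 0" "\<beta> \<ge> 1"
    and "Re (E (op_abs X [^]\<^bsub>op_ring A\<^esub> L)) \<le> \<beta>"
  shows "Lnorm L X \<le> \<beta>"
proof (rule Lnorm_le)
  have "cmod (E (op_prod (replicate L X))) = (\<integral>t. t ^ L \<partial>spectral_measure E X)"
    unfolding E_op_prod_replicate[OF assms(1,2)] norm_of_real
    using assms(3) by (simp add: integral_nonneg_AE zero_le_even_power)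
  also have "\<dots> \<le> \<beta>"
    using assms(6) E_abs_power[OF assms(1,2), of L] assms(3) by (simp add: power_even_abs)
  also have "\<dots> \<le> \<beta> ^ L" using assms(4,5) by (intro self_le_power) auto
  finally show "cmod (E (op_prod (replicate L X))) \<le> \<beta> ^ L" .
qed (use assms in auto)

lemma T_moment_asymptotics:
  fixes \<sigma> :: "nat \<Rightarrow> real"
  assumes bounded: "\<And>L. even L \<Longrightarrow> L > 0 \<Longrightarrow> \<exists>\<beta>\<ge>1. \<forall>i\<ge>1. Lnorm L (\<xi> i) \<le> \<beta>"
    and \<sigma>: "\<And>i. i \<ge> 1 \<Longrightarrow> E (op_mult (\<xi> i) (\<xi> i)) = of_real ((\<sigma> i)\<^sup>2)"
  shows "\<exists>C. \<forall>n. \<bar>m k n - (\<integral>x. x ^ k \<partial>semicircle_measure) * sqrt (\<Sum>i=1..n. (\<sigma> i)\<^sup>2) ^ k\<bar> * sqrt (real n + 1)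
           \<le> C * sqrt (real n + 1) ^ k"
proof -
  \<comment> \<open>The recursion counts from 0, the sequence from 1.\<close>
  define \<delta> where "\<delta> n = (\<sigma> (Suc n))\<^sup>2" for n
  obtain \<beta> where \<beta>: "\<beta> \<ge> 1" "\<And>i. i \<ge> 1 \<Longrightarrow> Lnorm 2 (\<xi> i) \<le> \<beta>" using bounded[of 2] by auto
  have EY: "E (op_mult (\<xi> (Suc n)) (\<xi> (Suc n))) = of_real (\<delta> n)" for n
    using \<sigma>[of "Suc n"] by (simp add: \<delta>_def)
  have \<delta>_le: "\<delta> n \<le> \<beta>\<^sup>2" for n
  proof -
    have "op_prod (replicate 2 (\<xi> (Suc n))) = op_mult (\<xi> (Suc n)) (\<xi> (Suc n))"
      using \<xi>_in[of "Suc n"] by (simp add: numeral_2_eq_2)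
    then have "\<delta> n = Lnorm 2 (\<xi> (Suc n)) ^ 2"
      by (simp only: Lnorm_power[OF pos2] EY norm_of_real) (simp add: \<delta>_def)
    also have "\<dots> \<le> \<beta>\<^sup>2" using \<beta> by (intro power_mono) auto
    finally show ?thesis .
  qed
  have "\<exists>C. \<forall>n. \<bar>m k n - (\<integral>x. x ^ k \<partial>semicircle_measure) * sqrt (\<Sum>i<n. \<delta> i) ^ k\<bar> * sqrt (real n + 1)
           \<le> C * sqrt (real n + 1) ^ k"
  proof (rule semicircle.moment_recursion_asymptotics[where B = "\<beta>\<^sup>2"])
    show "m 0 n = 1" for n using E_T_power[of 0 n] E_one by simp
    show "m k 0 = 0" if "k > 0" for k
      using E_T_power[of k 0] op_prod_replicate_zero[OF that] by (simp add: T_0)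
    show "m k (Suc n) = m k n + \<delta> n * (\<Sum>a<k. \<Sum>b<k - 1 - a. m b n * m (k - 2 - b) n)"
      if "k \<le> 2" for k n
    proof -
      \<comment> \<open>No word of length at most 2 has three marked letters: all ranges of
        \<open>c\<close> are empty.\<close>
      have "(\<Sum>a<k. \<Sum>b<k - 1 - a. \<Sum>c<k - 1 - a - 1 - b.
          E (op_prod (replicate a (T n) @ \<xi> (Suc n) # replicate b (T n) @ \<xi> (Suc n)
            # replicate c (T n) @ \<xi> (Suc n) # replicate (k - 1 - a - 1 - b - 1 - c) (T (Suc n))))) = 0"
        by (intro sum.neutral ballI) (use that in auto)
      then have "complex_of_real (m k (Suc n))
          = complex_of_real (m k n + \<delta> n * (\<Sum>a<k. \<Sum>b<k - 1 - a. m b n * m (k - 2 - b) n))"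
        using E_power_Suc3[of k n] by (simp only: E_T_power EY of_real_add of_real_mult of_real_sum add_0_right)
      then show ?thesis by (simp only: of_real_eq_iff)
    qed
    show "\<exists>C. \<forall>n. \<bar>m k (Suc n) - m k n - \<delta> n * (\<Sum>a<k. \<Sum>b<k - 1 - a. m b n * m (k - 2 - b) n)\<bar>
        \<le> C * sqrt (real n + 1) ^ (k - 3)" if k: "k \<ge> 3" for k
    proof -
      obtain \<beta>' where "\<beta>' \<ge> 1" "\<And>i. i \<ge> 1 \<Longrightarrow> Lnorm (2 * k) (\<xi> i) \<le> \<beta>'"
        using bounded[of "2 * k"] k by auto
      from E_third_order_remainder[OF _ this] k show ?thesis
        unfolding E_T_power EY
        by (simp only: norm_of_real flip: of_real_diff of_real_mult of_real_sum)
    qed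
  qed (use \<delta>_le in \<open>auto simp: \<delta>_def\<close>)
  then show ?thesis by (simp add: \<delta>_def sum.atLeast1_atMost_eq)
qed

end

text \<open>Since \<open>v n\<close> grows like s * n, dividing by \<open>sqrt (v n) ^ k\<close>
  turns the error bound into a convergent factor times 1 / sqrt (n + 1).\<close>

lemma tendsto_ratio_of_error_bound:
  fixes f v :: "nat \<Rightarrow> real"
  assumes v: "(\<lambda>n. v n / real n) \<longlonglongrightarrow> s" "s > 0"
    and bound: "\<And>n. \<bar>f n - c * sqrt (v n) ^ k\<bar> * sqrt (real n + 1) \<le> C * sqrt (real n + 1) ^ k"
  shows "(\<lambda>n. (1 / sqrt (v n)) ^ k * f n) \<longlonglongrightarrow> c"
proof -
  define r where "r n = sqrt (real n + 1)" for n
  have r: "r n > 0" for n by (simp add: r_def)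
  have v_pos: "\<forall>\<^sub>F n in sequentially. v n > 0"
    using order_tendstoD(1)[OF v] eventually_gt_at_top[of 0]
    by eventually_elim (simp add: zero_less_divide_iff)
  have "(\<lambda>n. (1 + 1 / real n) / (v n / real n)) \<longlonglongrightarrow> (1 + 0) / s"
    using v by (intro tendsto_intros lim_1_over_n) auto
  moreover have "\<forall>\<^sub>F n in sequentially. (1 + 1 / real n) / (v n / real n) = (real n + 1) / v n"
    using v_pos eventually_gt_at_top[of 0] by eventually_elim (simp add: divide_simps)
  ultimately have "(\<lambda>n. (real n + 1) / v n) \<longlonglongrightarrow> (1 + 0) / s" by (rule Lim_transform_eventually)
  then have lim: "(\<lambda>n. sqrt ((real n + 1) / v n)) \<longlonglongrightarrow> sqrt ((1 + 0) / s)"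
    by (rule tendsto_real_sqrt)
  have "(\<lambda>n. inverse (r n)) \<longlonglongrightarrow> 0"
    using tendsto_real_sqrt[OF LIMSEQ_inverse_real_of_nat]
    by (simp add: r_def real_sqrt_inverse add.commute)
  from tendsto_mult[OF tendsto_mult[OF tendsto_const tendsto_power[OF lim]] this]
  have lim0: "(\<lambda>n. C * sqrt ((real n + 1) / v n) ^ k * inverse (r n)) \<longlonglongrightarrow> 0" by simp
  have "(\<lambda>n. (1 / sqrt (v n)) ^ k * f n - c) \<longlonglongrightarrow> 0"
  proof (rule Lim_null_comparison[OF _ lim0])
    show "\<forall>\<^sub>F n in sequentially. norm ((1 / sqrt (v n)) ^ k * f n - c)
        \<le> C * sqrt ((real n + 1) / v n) ^ k * inverse (r n)"
      using v_pos
    proof eventually_elim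
      case (elim n)
      define w where "w = sqrt (v n)"
      have w: "w > 0" using elim by (simp add: w_def)
      have "(1 / w) ^ k * f n - c = (1 / w) ^ k * (f n - c * w ^ k)"
        using w by (simp add: field_simps power_one_over)
      then have "norm ((1 / w) ^ k * f n - c) = (1 / w) ^ k * \<bar>f n - c * w ^ k\<bar>"
        using w by (simp add: abs_mult)
      also have "\<bar>f n - c * w ^ k\<bar> \<le> C * r n ^ k * inverse (r n)"
        using bound[of n] r[of n] by (simp add: w_def r_def field_simps)
      finally have "norm ((1 / w) ^ k * f n - c) \<le> (1 / w) ^ k * (C * r n ^ k * inverse (r n))"
        using w by (simp add: mult_left_mono)
      also have "\<dots> = C * sqrt ((real n + 1) / v n) ^ k * inverse (r n)"
        by (simp add: w_def r_def real_sqrt_divide power_divide)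
      finally show ?case by (simp add: w_def)
    qed
  qed
  then show ?thesis by (simp add: LIM_zero_iff)
qed

section \<open>The central limit theorem\<close>

theorem theorem5:
  fixes A :: "'h::complex_hilbert oper set"
    and E :: "'h oper \<Rightarrow> complex"
    and \<xi> :: "nat \<Rightarrow> 'h oper"
    and \<sigma> :: "nat \<Rightarrow> real"
    and s :: real
  assumes "nc_random_space A E"
    and "\<And>i. i \<ge> 1 \<Longrightarrow> \<xi> i \<in> A"
    and "\<And>i. i \<ge> 1 \<Longrightarrow> self_adjoint (\<xi> i)"
    and "condition_A E \<xi>"
    and "\<And>k::nat. k \<ge> 1 \<Longrightarrow> \<exists>\<mu>::real. \<forall>i\<ge>1. Re (E (op_abs (\<xi> i) [^]\<^bsub>op_ring A\<^esub> k)) \<le> \<mu>"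
    and "\<And>i. i \<ge> 1 \<Longrightarrow> E (\<xi> i) = 0"
    and "\<And>i. i \<ge> 1 \<Longrightarrow> E (op_mult (\<xi> i) (\<xi> i)) = of_real ((\<sigma> i)\<^sup>2)"
    and "(\<lambda>N. (\<Sum>i=1..N. (\<sigma> i)\<^sup>2) / real N) \<longlonglongrightarrow> s"
    and "0 < s"
  shows "weak_conv_m
           (\<lambda>N. spectral_measure E
              (op_scale (of_real (1 / sqrt (\<Sum>i=1..N. (\<sigma> i)\<^sup>2))) (\<Oplus>\<^bsub>op_ring A\<^esub>i\<in>{1..N}. \<xi> i)))
           semicircle_measure"
proof -
  interpret nc_random_space A E by (rule assms(1))
  interpret condition_A_sequence A E \<xi> by unfold_locales (fact assms(2-4))+
  define v where "v N = (\<Sum>i=1..N. (\<sigma> i)\<^sup>2)" for N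
  have bounded: "\<exists>\<beta>\<ge>1. \<forall>i\<ge>1. Lnorm L (\<xi> i) \<le> \<beta>" if L: "even L" "L > 0" for L
  proof -
    obtain \<mu> where \<mu>: "\<And>i. i \<ge> 1 \<Longrightarrow> Re (E (op_abs (\<xi> i) [^]\<^bsub>op_ring A\<^esub> L)) \<le> \<mu>"
      using assms(5)[of L] L by auto
    have "Lnorm L (\<xi> i) \<le> max 1 \<mu>" if "i \<ge> 1" for i
      by (rule Lnorm_le_of_abs_moment) (use assms(2,3) \<mu> that L in \<open>auto simp: le_max_iff_disj\<close>)
    then show ?thesis by (intro exI[of _ "max 1 \<mu>"]) auto
  qed
  \<comment> \<open>While \<open>v N\<close> = 0 the factor \<open>1 / sqrt (v N)\<close> is 0 by
    convention. The scaled operator is still a self-adjoint element of \<open>A\<close>, so each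
    measure in the sequence is a distribution with all moments.\<close>
  have "weak_conv_m (\<lambda>N. spectral_measure E (op_scale (of_real (1 / sqrt (v N))) (T N))) semicircle_measure"
  proof (rule weak_conv_m_moments)
    show "real_distribution (spectral_measure E (op_scale (of_real (1 / sqrt (v N))) (T N)))" for N
      by (rule real_distribution_spectral_measure[OF scale_closed[OF T_in] self_adjoint_scale_T])
    show "integrable (spectral_measure E (op_scale (of_real (1 / sqrt (v N))) (T N))) (\<lambda>x. x ^ k)" for N k
      by (rule integrable_moment[OF scale_closed[OF T_in] self_adjoint_scale_T])
    show "integrable semicircle_measure (\<lambda>x. x ^ k)" for k
      using has_bochner_integral_semicircle by (rule integrable.intros)
    fix k
    obtain C where C: "\<And>n. \<bar>m k n - (\<integral>x. x ^ k \<partial>semicircle_measure) * sqrt (v n) ^ k\<bar> * sqrt (real n + 1)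
        \<le> C * sqrt (real n + 1) ^ k"
      using T_moment_asymptotics[OF bounded assms(7), of k] by (auto simp: v_def)
    have "(\<lambda>N. v N / real N) \<longlonglongrightarrow> s" using assms(8) by (simp add: v_def)
    from tendsto_ratio_of_error_bound[OF this assms(9) C]
    show "(\<lambda>N. \<integral>x. x ^ k \<partial>spectral_measure E (op_scale (of_real (1 / sqrt (v N))) (T N)))
        \<longlonglongrightarrow> (\<integral>x. x ^ k \<partial>semicircle_measure)"
      unfolding moment_scale_T .
  qed (fact real_distribution_semicircle semicircle_moment_growth)+
  then show ?thesis by (simp only: v_def T_def)
qed

end
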